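(* Let $p$ be fixed and consider the linear model $y_i=\mathbf{x}_i^T\mathbf{b}^*+\epsilon_i$, $i=1,\dots,n$, with $\mathbf{x}_i\in\mathbb{R}^p$, $\mathbf{b}^*\in\mathbb{R}^p$ and $\epsilon_1,\dots,\epsilon_n$ i.i.d. with mean $0$ and variance $\sigma^2$. Let $\mathbf{y}=(y_1,\dots,y_n)^T$, $\mathbf{X}=[\mathbf{x}_1,\dots,\mathbf{x}_n]^T$, and assume $\mathbf{X}^T\mathbf{X}/n\to\mathbf{C}$ for a positive definite matrix $\mathbf{C}$. Define \[ \tilde{\mathbf{b}}_n=\arg\min_{\mathbf{b}}\ \|\mathbf{y}-\mathbf{X}\mathbf{b}\|_2^2+\frac{\eta_n}{\alpha_n}\sum_{j=1}^p\Big[\sqrt{1+2\alpha_n|b_j|}-1\Big], \] with $\eta_n>0$, $\alpha_n>0$. Assume $\lim_{n\to\infty}\alpha_n=0$. If $\lim_{n\to\infty}\eta_n/\sqrt n=2c_3\in[0,\infty)$, then $\tilde{\mathbf{b}}_n\xrightarrow{p}\mathbf{b}^*$. Furthermore, if $\lim_{n\to\infty}\eta_n/\sqrt n=0$, then $\sqrt n(\tilde{\mathbf{b}}_n-\mathbf{b}^* )\xrightarrow{d}N(\mathbf{0},\sigma^2\mathbf{C}^{-1})$. *)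

theory Defs
  imports "HOL-Probability.Probability"
begin

definition pos_def_mat :: "real^'p^'p \<Rightarrow> bool" where
  "pos_def_mat C \<longleftrightarrow> transpose C = C \<and> (\<forall>v. v \<noteq> 0 \<longrightarrow> v \<bullet> (C *v v) > 0)"

text \<open>Gram matrix X^T X of the first n design rows x 0, ..., x (n-1)
  (row x k plays the role of x_{k+1}).\<close>
definition gram :: "(nat \<Rightarrow> real^'p) \<Rightarrow> nat \<Rightarrow> real^'p^'p" where
  "gram x n = (\<chi> i j. \<Sum>k<n. x k $ i * x k $ j)"

definition sqrt_pen_obj :: "(nat \<Rightarrow> real^'p) \<Rightarrow> (nat \<Rightarrow> real) \<Rightarrow> nat \<Rightarrow> real \<Rightarrow> real \<Rightarrow> real^'p \<Rightarrow> real" where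
  "sqrt_pen_obj x y n eta alpha b =
     (\<Sum>k<n. (y k - x k \<bullet> b)^2) + eta / alpha * (\<Sum>j\<in>UNIV. sqrt (1 + 2 * alpha * \<bar>b $ j\<bar>) - 1)"

text \<open>N is the (possibly degenerate) multivariate normal N(0, S) on R^p,
  defined via its characteristic function.\<close>
definition mvnormal0 :: "(real^'p) measure \<Rightarrow> real^'p^'p \<Rightarrow> bool" where
  "mvnormal0 N S \<longleftrightarrow> prob_space N \<and> sets N = sets borel \<and>
     (\<forall>t. (CLINT z|N. cis (t \<bullet> z)) = complex_of_real (exp (- (t \<bullet> (S *v t)) / 2)))"

definition conv_in_dist :: "'a measure \<Rightarrow> (nat \<Rightarrow> 'a \<Rightarrow> real^'p) \<Rightarrow> (real^'p) measure \<Rightarrow> bool" where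
  "conv_in_dist M Z N \<longleftrightarrow>
     (\<forall>f :: real^'p \<Rightarrow> real. continuous_on UNIV f \<and> bounded (range f) \<longrightarrow>
        (\<lambda>n. integral\<^sup>L M (\<lambda>\<omega>. f (Z n \<omega>))) \<longlonglongrightarrow> integral\<^sup>L N f)"

definition conv_in_prob :: "'a measure \<Rightarrow> (nat \<Rightarrow> 'a \<Rightarrow> real^'p) \<Rightarrow> real^'p \<Rightarrow> bool" where
  "conv_in_prob M Z c \<longleftrightarrow>
     (\<forall>e>0. (\<lambda>n. measure M {\<omega>\<in>space M. dist (Z n \<omega>) c > e}) \<longlonglongrightarrow> 0)"

end

theory Submission
  imports Defs
begin

text \<open>
  As a function of \<open>b\<close> the penalty is Lipschitz with constant proportional to \<open>eta n\<close>, whatever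
  \<open>alpha n\<close> is. Write \<open>G n\<close> for the normalized Gram matrix and \<open>U n = C\<^sup>-\<^sup>1 X\<^sup>T eps / sqrt n\<close>. Comparing
  the criterion at the minimizer and at \<open>bstar + U n / sqrt n\<close>, and using that the quadratic part is
  uniformly coercive, gives pointwise
  \<open>norm (sqrt n (btil n - bstar) - U n) \<le> const * (norm (C - G n) * norm (U n) + eta n / sqrt n)\<close>.
  Since \<open>U n\<close> is bounded in mean, consistency is Markov's inequality, and when \<open>eta n / sqrt n\<close>
  vanishes the rescaled error has the same limiting characteristic function as \<open>U n\<close>, which is a
  weighted sum of the errors with asymptotically negligible weights. Characteristic functions
  determine the weak limit of a tight sequence because trigonometric polynomials are dense in the
  continuous functions on each ball.
\<close>

subsection \<open>Trigonometric polynomials and weak convergence\<close>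

text \<open>The phase \<open>b\<close> makes sines available and \<open>t = 0\<close> gives the
  constants, so cosines and sums alone generate a real algebra: a product of two cosines is again a
  sum of two cosines. Each generator is the real part of a multiple of
  \<open>cis (t \<bullet> z)\<close>, whose expectation is a characteristic function.\<close>

inductive_set trig_poly :: "(real^'p \<Rightarrow> real) set" where
  cos: "(\<lambda>z. a * cos (t \<bullet> z + b)) \<in> trig_poly"
| add: "g \<in> trig_poly \<Longrightarrow> h \<in> trig_poly \<Longrightarrow> (\<lambda>z. g z + h z) \<in> trig_poly"

lemma trig_poly_const: "(\<lambda>_. c) \<in> trig_poly"
  using trig_poly.cos[of c 0 0] by simp

lemma trig_poly_mult:
  assumes "g \<in> trig_poly" "h \<in> trig_poly"
  shows "(\<lambda>z. g z * h z) \<in> trig_poly"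
  using assms(1)
proof induction
  case (cos a t b)
  show ?case
    using assms(2)
  proof induction
    case (cos a' t' b')
    have "(\<lambda>z. a * cos (t \<bullet> z + b) * (a' * cos (t' \<bullet> z + b'))) =
        (\<lambda>z. a * a' / 2 * cos ((t - t') \<bullet> z + (b - b')) + a * a' / 2 * cos ((t + t') \<bullet> z + (b + b')))"
    proof
      fix z
      have eq: "(t - t') \<bullet> z + (b - b') = (t \<bullet> z + b) - (t' \<bullet> z + b')"
        "(t + t') \<bullet> z + (b + b') = (t \<bullet> z + b) + (t' \<bullet> z + b')"
        by (simp_all add: inner_add_left inner_diff_left)
      show "a * cos (t \<bullet> z + b) * (a' * cos (t' \<bullet> z + b')) =
          a * a' / 2 * cos ((t - t') \<bullet> z + (b - b')) + a * a' / 2 * cos ((t + t') \<bullet> z + (b + b'))"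
        unfolding eq cos_add cos_diff by (simp add: field_simps)
    qed
    then show ?case
      by (simp only: trig_poly.intros)
  qed (simp add: distrib_left trig_poly.add)
qed (simp add: distrib_right trig_poly.add)

lemma continuous_on_trig_poly:
  assumes "g \<in> trig_poly"
  shows "continuous_on S g"
  using assms by induction (intro continuous_intros | assumption)+

lemma bounded_trig_poly:
  assumes "g \<in> trig_poly"
  obtains B where "\<And>z. \<bar>g z\<bar> \<le> B"
proof -
  have "\<exists>B. \<forall>z. \<bar>g z\<bar> \<le> B"
    using assms
  proof induction
    case (cos a t b)
    show ?case
      by (rule exI[of _ "\<bar>a\<bar>"]) (auto simp: abs_mult intro: mult_left_le)
  next
    case (add g h)
    then obtain B B' where "\<forall>z. \<bar>g z\<bar> \<le> B" "\<forall>z. \<bar>h z\<bar> \<le> B'"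
      by blast
    then have "\<forall>z. \<bar>g z + h z\<bar> \<le> B + B'"
      by (metis abs_triangle_ineq add_mono order_trans)
    then show ?case
      by blast
  qed
  then show thesis
    using that by blast
qed

lemma trig_poly_compose_polynomial:
  fixes q :: "real \<Rightarrow> real"
  assumes "real_polynomial_function q" "g \<in> trig_poly"
  shows "(\<lambda>z. q (g z)) \<in> trig_poly"
  using assms(1)
proof induction
  case (linear f)
  then have "f = (\<lambda>x. f 1 * x)"
    by (metis real_bounded_linear mult.commute mult_1)
  then show ?case
    using trig_poly_mult[OF trig_poly_const[of "f 1"] assms(2)] by metis
qed (simp_all add: trig_poly_const trig_poly.add trig_poly_mult)

lemma trig_poly_separates:
  fixes v w :: "real^'p"
  assumes "v \<noteq> w"
  shows "\<exists>g\<in>trig_poly. g v \<noteq> g w"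
proof -
  define s where "s = (norm (v - w))\<^sup>2"
  have s: "s > 0"
    using assms by (simp add: s_def)
  \<comment> \<open>The scaling makes the phases of \<open>v\<close> and \<open>w\<close> differ by
    exactly \<open>pi / 2\<close>; with the shift \<open>- (t \<bullet> w)\<close> the cosine is 0
    at \<open>v\<close> and 1 at \<open>w\<close>.\<close>
  define t where "t = (pi / (2 * s)) *\<^sub>R (v - w)"
  have "t \<bullet> v - t \<bullet> w = pi / 2"
    using s by (simp only: t_def s_def power2_norm_eq_inner flip: inner_diff_right) simp
  then have *: "t \<bullet> v + (- (t \<bullet> w)) = pi / 2"
    by simp
  have "1 * cos (t \<bullet> v + (- (t \<bullet> w))) \<noteq> 1 * cos (t \<bullet> w + (- (t \<bullet> w)))"
    unfolding * by simp
  then show ?thesis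
    using trig_poly.cos[of 1 t "- (t \<bullet> w)"] by (intro bexI)
qed

text \<open>Stone--Weierstrass only controls the approximant on a compact set; composing it with a
  polynomial close to truncation at height \<open>B\<close> keeps it bounded everywhere.\<close>
lemma bounded_trig_poly_approximation:
  fixes f :: "real^'p \<Rightarrow> real"
  assumes f: "continuous_on UNIV f" and B: "\<And>z. \<bar>f z\<bar> \<le> B" and e: "e > 0" and S: "compact S"
  obtains h where "h \<in> trig_poly" "\<And>z. \<bar>h z\<bar> \<le> B + e" "\<And>z. z \<in> S \<Longrightarrow> \<bar>f z - h z\<bar> \<le> e"
proof -
  have e2: "e / 2 > 0"
    using e by simp
  interpret function_ring_on trig_poly S
    by unfold_locales
      (simp_all add: S continuous_on_trig_poly trig_poly.add trig_poly_mult trig_poly_const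
        trig_poly_separates)
  obtain g where g: "g \<in> trig_poly" "\<And>z. z \<in> S \<Longrightarrow> \<bar>f z - g z\<bar> < e / 2"
    using Stone_Weierstrass_basic[OF continuous_on_subset[OF f subset_UNIV] e2] by blast
  obtain K where K: "\<And>z. \<bar>g z\<bar> \<le> K"
    using bounded_trig_poly[OF g(1)] by blast
  \<comment> \<open>\<open>c\<close> is truncation to \<open>[-B, B]\<close>. It fixes every value
    of \<open>f\<close>, so truncating an approximant never moves it away from
    \<open>f\<close>.\<close>
  define c where "c y = max (- B) (min B y)" for y :: real
  have "B \<ge> 0"
    using B[of 0] by linarith
  then have c: "\<bar>c y\<bar> \<le> B" "\<bar>a\<bar> \<le> B \<Longrightarrow> \<bar>a - c y\<bar> \<le> \<bar>a - y\<bar>" for a y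
    unfolding c_def by linarith+
  have "continuous_on {-K..K} c"
    unfolding c_def by (intro continuous_intros)
  \<comment> \<open>The interval contains all values of \<open>g\<close> on the whole space. Hence
    \<open>q (g z)\<close> is close to the truncated \<open>g z\<close> everywhere, and not only on
    \<open>S\<close>; this gives the global bound.\<close>
  from Stone_Weierstrass_polynomial_function[OF compact_Icc this e2]
  obtain q :: "real \<Rightarrow> real" where q: "polynomial_function q"
    "\<And>y. y \<in> {-K..K} \<Longrightarrow> norm (c y - q y) < e / 2"
    by auto
  have q_close: "\<bar>c (g z) - q (g z)\<bar> < e / 2" for z
  proof -
    have "g z \<in> {-K..K}"
      using K[of z] by (simp add: abs_le_iff)
    from q(2)[OF this] show ?thesis
      by simp
  qed
  show thesis
  proof (rule that[of "\<lambda>z. q (g z)"])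
    show "(\<lambda>z. q (g z)) \<in> trig_poly"
      using q(1) g(1) by (simp add: trig_poly_compose_polynomial real_polynomial_function_eq)
    show "\<bar>q (g z)\<bar> \<le> B + e" for z
      using q_close[of z] c(1)[of "g z"] e by linarith
    show "\<bar>f z - q (g z)\<bar> \<le> e" if "z \<in> S" for z
      using q_close[of z] c(2)[OF B[of z], of "g z"] g(2)[OF that] by linarith
  qed
qed

section \<open>Expectations of trigonometric polynomials in terms of characteristic
  functions\<close>

lemma cos_eq_Re_cis_mult: "cos (y + b) = Re (cis b * cis y)"
  by (simp add: cis_mult add.commute)

lemma (in prob_space) integrable_cis:
  assumes "X \<in> borel_measurable M"
  shows "integrable M (\<lambda>\<omega>. cis (X \<omega>))"
  by (rule integrable_const_bound[where B = 1]) (use assms in \<open>simp_all add: cis_conv_exp\<close>)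

lemma (in prob_space) integral_cos_eq_Re_cis:
  assumes "X \<in> borel_measurable M"
  shows "(\<integral>\<omega>. cos (X \<omega> + b) \<partial>M) = Re (cis b * (CLINT \<omega>|M. cis (X \<omega>)))"
proof -
  have "(\<integral>\<omega>. cos (X \<omega> + b) \<partial>M) = (\<integral>\<omega>. Re (cis b * cis (X \<omega>)) \<partial>M)"
    by (simp only: cos_eq_Re_cis_mult)
  also have "\<dots> = Re (CLINT \<omega>|M. cis b * cis (X \<omega>))"
    using integrable_cis[OF assms] by (intro integral_Re integrable_mult_right) auto
  finally show ?thesis
    by simp
qed

lemma trig_poly_borel: "g \<in> trig_poly \<Longrightarrow> g \<in> borel_measurable borel"
  by (intro borel_measurable_continuous_onI continuous_on_trig_poly)

lemma (in prob_space) integrable_bounded_real: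
  fixes h :: "'b::topological_space \<Rightarrow> real"
  assumes "h \<in> borel_measurable borel" "\<And>z. \<bar>h z\<bar> \<le> B" "Z \<in> borel_measurable M"
  shows "integrable M (\<lambda>\<omega>. h (Z \<omega>))"
  by (rule integrable_const_bound[where B = B]) (use assms in auto)

text \<open>On a generator the expectation is a fixed real-linear function of the characteristic
  function at \<open>t\<close>, so it inherits the limit. Sums follow by linearity, where
  boundedness supplies integrability.\<close>

lemma trig_poly_expectation_tendsto:
  fixes Z :: "nat \<Rightarrow> 'a \<Rightarrow> real^'p" and N :: "(real^'p) measure"
  assumes M: "prob_space M" and N: "prob_space N" "sets N = sets borel"
    and Z: "\<And>n. Z n \<in> borel_measurable M"
    and char: "\<And>t. (\<lambda>n. CLINT \<omega>|M. cis (t \<bullet> Z n \<omega>)) \<longlonglongrightarrow> (CLINT z|N. cis (t \<bullet> z))"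
    and h: "h \<in> trig_poly"
  shows "(\<lambda>n. \<integral>\<omega>. h (Z n \<omega>) \<partial>M) \<longlonglongrightarrow> (\<integral>z. h z \<partial>N)"
  using h
proof induction
  case (cos a t b)
  have [measurable]: "Z n \<in> borel_measurable M" for n
    by (rule Z)
  have [measurable]: "(\<lambda>z. t \<bullet> z) \<in> borel_measurable N"
    by (simp add: measurable_cong_sets[OF N(2) refl])
  have "(\<lambda>n. a * Re (cis b * (CLINT \<omega>|M. cis (t \<bullet> Z n \<omega>)))) \<longlonglongrightarrow>
      a * Re (cis b * (CLINT z|N. cis (t \<bullet> z)))"
    by (intro tendsto_intros char)
  then show ?case
    by (simp add: prob_space.integral_cos_eq_Re_cis[OF M] prob_space.integral_cos_eq_Re_cis[OF N(1)])
next
  case (add g h)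
  obtain Bg where Bg: "\<And>z. \<bar>g z\<bar> \<le> Bg"
    using bounded_trig_poly[OF add.hyps(1)] by blast
  obtain Bh where Bh: "\<And>z. \<bar>h z\<bar> \<le> Bh"
    using bounded_trig_poly[OF add.hyps(2)] by blast
  have id: "(\<lambda>z. z) \<in> borel_measurable N"
    by (simp add: measurable_cong_sets[OF N(2) refl])
  have "(\<integral>\<omega>. g (Z n \<omega>) + h (Z n \<omega>) \<partial>M) = (\<integral>\<omega>. g (Z n \<omega>) \<partial>M) + (\<integral>\<omega>. h (Z n \<omega>) \<partial>M)" for n
    using prob_space.integrable_bounded_real[OF M trig_poly_borel[OF add.hyps(1)] Bg Z]
      prob_space.integrable_bounded_real[OF M trig_poly_borel[OF add.hyps(2)] Bh Z]
    by simp
  moreover have "(\<integral>z. g z + h z \<partial>N) = (\<integral>z. g z \<partial>N) + (\<integral>z. h z \<partial>N)"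
    using prob_space.integrable_bounded_real[OF N(1) trig_poly_borel[OF add.hyps(1)] Bg id]
      prob_space.integrable_bounded_real[OF N(1) trig_poly_borel[OF add.hyps(2)] Bh id]
    by simp
  ultimately show ?case
    using tendsto_add[OF add.IH] by simp
qed

section \<open>Tail bounds and passage from trigonometric polynomials to bounded continuous
  functions\<close>

lemma (in prob_space) tight_single:
  fixes X :: "'a \<Rightarrow> 'b::real_normed_vector"
  assumes [measurable]: "(\<lambda>\<omega>. norm (X \<omega>)) \<in> borel_measurable M" and e: "e > 0"
  obtains R where "prob {\<omega> \<in> space M. norm (X \<omega>) > R} \<le> e"
proof -
  define A where "A n = {\<omega> \<in> space M. norm (X \<omega>) > real n}" for n
  have "(\<lambda>n. prob (A n)) \<longlonglongrightarrow> prob (\<Inter>n. A n)"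
  proof (rule finite_Lim_measure_decseq)
    show "range A \<subseteq> events"
      unfolding A_def by auto
    show "decseq A"
      unfolding A_def by (intro decseq_SucI) auto
  qed
  moreover have "(\<Inter>n. A n) = {}"
    unfolding A_def using reals_Archimedean2 not_less_iff_gr_or_eq by fastforce
  ultimately have "(\<lambda>n. prob (A n)) \<longlonglongrightarrow> 0"
    by simp
  then have "eventually (\<lambda>n. prob (A n) < e) sequentially"
    using e by (rule order_tendstoD)
  then obtain n where "prob (A n) < e"
    using eventually_sequentially by auto
  then show thesis
    using that[of "real n"] unfolding A_def by simp
qed

lemma (in prob_space) markov_norm:
  fixes X :: "'a \<Rightarrow> 'b::{banach, second_countable_topology}"
  assumes "integrable M X" "R > 0"
  shows "prob {\<omega> \<in> space M. norm (X \<omega>) > R} \<le> (\<integral>\<omega>. norm (X \<omega>) \<partial>M) / R"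
proof -
  have [measurable]: "X \<in> borel_measurable M"
    using assms(1) by simp
  have "prob {\<omega> \<in> space M. norm (X \<omega>) > R} \<le> prob {\<omega> \<in> space M. norm (X \<omega>) \<ge> R}"
    by (rule finite_measure_mono) auto
  also have "\<dots> \<le> (\<integral>\<omega>. norm (X \<omega>) \<partial>M) / R"
    using assms by (intro integral_Markov_inequality_measure[where A = "{}"]) auto
  finally show ?thesis .
qed

text \<open>On the ball the integrands differ by at most \<open>e\<close>; off the ball the
  difference is at most \<open>2 * B + e\<close>, on an event of probability at most
  \<open>d\<close>.\<close>

lemma (in prob_space) expectation_diff_le_off_ball:
  fixes f h :: "'b::real_normed_vector \<Rightarrow> real"
  assumes f: "f \<in> borel_measurable borel" "\<And>z. \<bar>f z\<bar> \<le> B"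
    and h: "h \<in> borel_measurable borel" "\<And>z. \<bar>h z\<bar> \<le> B + e"
    and close: "\<And>z. norm z \<le> R \<Longrightarrow> \<bar>f z - h z\<bar> \<le> e"
    and Z: "Z \<in> borel_measurable M" and e: "e \<ge> 0"
    and tail: "prob {\<omega> \<in> space M. norm (Z \<omega>) > R} \<le> d"
  shows "\<bar>(\<integral>\<omega>. f (Z \<omega>) \<partial>M) - (\<integral>\<omega>. h (Z \<omega>) \<partial>M)\<bar> \<le> e + (2 * B + e) * d"
proof -
  define A where "A = {\<omega> \<in> space M. norm (Z \<omega>) > R}"
  have [measurable]: "Z \<in> borel_measurable M" and A[measurable]: "A \<in> events"
    using Z unfolding A_def by auto
  have B: "B \<ge> 0"
    using f(2)[of undefined] by linarith
  note int = integrable_bounded_real[OF f Z] integrable_bounded_real[OF h Z]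
  have pointwise: "\<bar>f (Z \<omega>) - h (Z \<omega>)\<bar> \<le> e + (2 * B + e) * indicator A \<omega>" if "\<omega> \<in> space M" for \<omega>
  proof (cases "\<omega> \<in> A")
    case True
    then show ?thesis
      using f(2)[of "Z \<omega>"] h(2)[of "Z \<omega>"] e by (simp add: abs_le_iff)
  next
    case False
    then show ?thesis
      using close[of "Z \<omega>"] that by (simp add: A_def)
  qed
  have "\<bar>(\<integral>\<omega>. f (Z \<omega>) \<partial>M) - (\<integral>\<omega>. h (Z \<omega>) \<partial>M)\<bar> = \<bar>\<integral>\<omega>. f (Z \<omega>) - h (Z \<omega>) \<partial>M\<bar>"
    using int by simp
  also have "\<dots> \<le> (\<integral>\<omega>. \<bar>f (Z \<omega>) - h (Z \<omega>)\<bar> \<partial>M)"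
    by (rule integral_abs_bound)
  also have "\<dots> \<le> (\<integral>\<omega>. e + (2 * B + e) * indicator A \<omega> \<partial>M)"
    using int pointwise A by (intro integral_mono) (auto simp: integrable_real_indicator less_top[symmetric])
  also have "\<dots> = e + (2 * B + e) * prob A"
    using A by (subst Bochner_Integration.integral_add)
      (auto simp: integrable_real_indicator less_top[symmetric] prob_space)
  also have "\<dots> \<le> e + (2 * B + e) * d"
    using tail B e unfolding A_def by (intro add_left_mono mult_left_mono) auto
  finally show ?thesis .
qed

text \<open>The nontrivial half of the multivariate Levy continuity theorem, with tightness as a hypothesis.\<close>
lemma conv_in_dist_if_char_tendsto:
  fixes Z :: "nat \<Rightarrow> 'a \<Rightarrow> real^'p" and N :: "(real^'p) measure"
  assumes M: "prob_space M" and N: "prob_space N" "sets N = sets borel"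
    and Z: "\<And>n. Z n \<in> borel_measurable M"
    and char: "\<And>t. (\<lambda>n. CLINT \<omega>|M. cis (t \<bullet> Z n \<omega>)) \<longlonglongrightarrow> (CLINT z|N. cis (t \<bullet> z))"
    and tight: "eventually (\<lambda>n. integrable M (Z n) \<and> (\<integral>\<omega>. norm (Z n \<omega>) \<partial>M) \<le> K) sequentially"
  shows "conv_in_dist M Z N"
  unfolding conv_in_dist_def
proof (intro allI impI, elim conjE)
  fix f :: "real^'p \<Rightarrow> real"
  assume f: "continuous_on UNIV f" and "bounded (range f)"
  then obtain B where B: "\<And>z. \<bar>f z\<bar> \<le> B"
    unfolding bounded_iff by auto
  then have B0: "B \<ge> 0"
    by (meson abs_ge_zero order_trans)
  have f_borel: "f \<in> borel_measurable borel"
    using f by (rule borel_measurable_continuous_onI)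
  have idN: "(\<lambda>z. z) \<in> borel_measurable N"
    by (simp add: measurable_cong_sets[OF N(2) refl])
  show "(\<lambda>n. \<integral>\<omega>. f (Z n \<omega>) \<partial>M) \<longlonglongrightarrow> integral\<^sup>L N f"
  proof (rule LIMSEQ_I)
    fix r :: real
    assume r: "r > 0"
    \<comment> \<open>\<open>e \<le> 1\<close> lets \<open>e * e\<close> be absorbed into
      \<open>e\<close>, so that the error \<open>e + (2 * B + e) * e\<close> is at most
      \<open>(2 * B + 3) * e \<le> r / 4\<close>. Three such errors add up to less than
      \<open>r\<close>.\<close>
    define e where "e = min 1 (r / (4 * (2 * B + 3)))"
    have e: "e > 0" "e \<le> 1" and er: "4 * ((2 * B + 3) * e) \<le> r"
      using r B0 by (auto simp: e_def min_def divide_simps)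
    have normN: "(\<lambda>z. norm z) \<in> borel_measurable N"
      using idN by simp
    obtain R1 where R1: "measure N {z \<in> space N. norm z > R1} \<le> e"
      using prob_space.tight_single[OF N(1) normN e(1)] by blast
    \<comment> \<open>\<open>R1\<close> controls the tail of \<open>N\<close>;
      \<open>\<bar>K\<bar> / e\<close> makes Markov's inequality give tail probability at most
      \<open>e\<close> for \<open>Z n\<close>. The added 1 keeps \<open>R\<close> positive even if
      \<open>K = 0\<close>.\<close>
    define R where "R = max R1 (\<bar>K\<bar> / e + 1)"
    have R: "R > 0" "\<bar>K\<bar> / R \<le> e"
    proof -
      have "\<bar>K\<bar> / e \<ge> 0"
        using e by simp
      then show "R > 0"
        unfolding R_def by linarith
      moreover have "\<bar>K\<bar> / e \<le> R"
        unfolding R_def by linarith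
      ultimately show "\<bar>K\<bar> / R \<le> e"
        using e by (simp add: field_simps)
    qed
    have tailN: "measure N {z \<in> space N. norm z > R} \<le> e"
    proof -
      interpret N: prob_space N by (rule N(1))
      have "measure N {z \<in> space N. norm z > R} \<le> measure N {z \<in> space N. norm z > R1}"
        using normN by (intro N.finite_measure_mono) (auto simp: R_def)
      then show ?thesis
        using R1 by simp
    qed
    obtain h where h: "h \<in> trig_poly" "\<And>z. \<bar>h z\<bar> \<le> B + e" "\<And>z. z \<in> cball 0 R \<Longrightarrow> \<bar>f z - h z\<bar> \<le> e"
      using bounded_trig_poly_approximation[OF f B e(1) compact_cball] by blast
    have h_close: "\<And>z. norm z \<le> R \<Longrightarrow> \<bar>f z - h z\<bar> \<le> e"
      using h(3) by simp
    have bound: "e + (2 * B + e) * e \<le> r / 4"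
    proof -
      have "e + (2 * B + e) * e \<le> (2 * B + 3) * e"
        using e B0 by (simp add: algebra_simps)
      then show ?thesis
        using er by simp
    qed
    have diffN: "\<bar>(\<integral>z. f z \<partial>N) - (\<integral>z. h z \<partial>N)\<bar> \<le> r / 4"
      using prob_space.expectation_diff_le_off_ball[OF N(1) f_borel B trig_poly_borel[OF h(1)] h(2)
          h_close idN _ tailN] e bound by linarith
    have triangle: "\<bar>x - w\<bar> < r"
      if "\<bar>x - y\<bar> \<le> r / 4" "\<bar>y - z\<bar> < r / 4" "\<bar>w - z\<bar> \<le> r / 4" for x y z w :: real
      using that r by linarith
    have "eventually (\<lambda>n. \<bar>(\<integral>\<omega>. h (Z n \<omega>) \<partial>M) - (\<integral>z. h z \<partial>N)\<bar> < r / 4) sequentially"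
      using tendstoD[OF trig_poly_expectation_tendsto[OF M N Z char h(1)], of "r / 4"] r
      by (simp add: dist_real_def)
    then have "eventually (\<lambda>n. norm ((\<integral>\<omega>. f (Z n \<omega>) \<partial>M) - integral\<^sup>L N f) < r) sequentially"
      using tight
    proof eventually_elim
      case (elim n)
      have "measure M {\<omega> \<in> space M. norm (Z n \<omega>) > R} \<le> (\<integral>\<omega>. norm (Z n \<omega>) \<partial>M) / R"
        using elim(2) R(1) by (intro prob_space.markov_norm[OF M]) auto
      also have "\<dots> \<le> \<bar>K\<bar> / R"
        using elim(2) R(1) by (intro divide_right_mono) auto
      also have "\<dots> \<le> e"
        by (rule R(2))
      finally have "\<bar>(\<integral>\<omega>. f (Z n \<omega>) \<partial>M) - (\<integral>\<omega>. h (Z n \<omega>) \<partial>M)\<bar> \<le> e + (2 * B + e) * e"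
        using prob_space.expectation_diff_le_off_ball[OF M f_borel B trig_poly_borel[OF h(1)] h(2)
            h_close Z] e by simp
      then have "\<bar>(\<integral>\<omega>. f (Z n \<omega>) \<partial>M) - (\<integral>\<omega>. h (Z n \<omega>) \<partial>M)\<bar> \<le> r / 4"
        using bound by simp
      from triangle[OF this elim(1) diffN] show ?case
        unfolding real_norm_def .
    qed
    then show "\<exists>no. \<forall>n\<ge>no. norm ((\<integral>\<omega>. f (Z n \<omega>) \<partial>M) - integral\<^sup>L N f) < r"
      by (simp add: eventually_sequentially)
  qed
qed

subsection \<open>Positive definite matrices\<close>

text \<open>\<open>norm A\<close> is the Frobenius norm: Cauchy-Schwarz applies to each row, and the
  row norms combine in the Euclidean sum.\<close>

lemma norm_matrix_vector_mult_le:
  fixes A :: "real^'n^'m"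
  shows "norm (A *v x) \<le> norm A * norm x"
proof -
  have "norm (A *v x) \<le> L2_set (\<lambda>i. norm (A $ i) * norm x) UNIV"
    unfolding norm_vec_def[of "A *v x"]
    by (intro L2_set_mono)
      (simp_all add: matrix_vector_mul_component Cauchy_Schwarz_ineq2 flip: norm_vec_def)
  also have "\<dots> = norm A * norm x"
    by (simp add: L2_set_left_distrib norm_vec_def)
  finally show ?thesis .
qed

lemma inner_matrix_vector_mult_commute:
  fixes A :: "real^'p^'p"
  assumes "transpose A = A"
  shows "v \<bullet> (A *v w) = w \<bullet> (A *v v)"
  using dot_lmul_matrix[of v A w] assms
  by (metis inner_commute vector_transpose_matrix)

text \<open>The quadratic form attains a positive minimum on the compact unit sphere, and
  homogeneity of degree two carries this bound to all vectors.\<close>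

lemma pos_def_mat_lower_bound:
  fixes C :: "real^'p^'p"
  assumes "pos_def_mat C"
  obtains c where "c > 0" "\<And>v. c * (norm v)\<^sup>2 \<le> v \<bullet> (C *v v)"
proof -
  let ?S = "sphere (0 :: real^'p) 1"
  have "continuous_on ?S (\<lambda>v. v \<bullet> (C *v v))"
    by (intro continuous_intros matrix_vector_mult_linear_continuous_on)
  then obtain u where u: "u \<in> ?S" "\<And>v. v \<in> ?S \<Longrightarrow> u \<bullet> (C *v u) \<le> v \<bullet> (C *v v)"
    using continuous_attains_inf[of ?S "\<lambda>v. v \<bullet> (C *v v)"] by auto
  show thesis
  proof (rule that[of "u \<bullet> (C *v u)"])
    show "u \<bullet> (C *v u) > 0"
      using assms u(1) unfolding pos_def_mat_def by (metis dist_0_norm mem_sphere norm_zero zero_neq_one)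
    show "u \<bullet> (C *v u) * (norm v)\<^sup>2 \<le> v \<bullet> (C *v v)" for v
    proof (cases "v = 0")
      case False
      define w where "w = (1 / norm v) *\<^sub>R v"
      have v: "v = norm v *\<^sub>R w" and "w \<in> ?S"
        using False by (simp_all add: w_def)
      have "v \<bullet> (C *v v) = (norm v)\<^sup>2 * (w \<bullet> (C *v w))"
        by (subst (1 2) v) (simp add: matrix_vector_mult_scaleR power2_eq_square)
      then show ?thesis
        using u(2)[OF \<open>w \<in> ?S\<close>] by (simp add: mult.commute mult_right_mono)
    qed simp
  qed
qed

lemma pos_def_mat_invertible:
  fixes C :: "real^'p^'p"
  assumes "pos_def_mat C"
  shows "invertible C"
proof -
  have "v = 0" if "C *v v = 0" for v
    using assms that by (metis inner_zero_right less_irrefl pos_def_mat_def)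
  then show ?thesis
    by (metis invertible_left_inverse matrix_left_invertible_ker)
qed

lemma matrix_inv_inverse:
  fixes C :: "real^'n^'m"
  assumes "invertible C"
  shows matrix_inv_right: "C ** matrix_inv C = mat 1" and matrix_inv_left: "matrix_inv C ** C = mat 1"
  using assms someI_ex[of "\<lambda>A'. C ** A' = mat 1 \<and> A' ** C = mat 1"]
  unfolding invertible_def matrix_inv_def by auto

lemma matrix_inv_vector_mult:
  fixes C :: "real^'p^'p"
  assumes "invertible C"
  shows "C *v (matrix_inv C *v t) = t"
  using matrix_inv_right[OF assms] by (simp add: matrix_vector_mul_assoc)

lemma transpose_matrix_inv_eq:
  fixes C :: "real^'p^'p"
  assumes "invertible C" "transpose C = C"
  shows "transpose (matrix_inv C) = matrix_inv C"
proof -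
  have "transpose (matrix_inv C) ** C = mat 1"
    by (metis assms matrix_inv_right matrix_transpose_mul transpose_mat)
  then show ?thesis
    by (metis assms(1) matrix_inv_right matrix_mul_assoc matrix_mul_lid matrix_mul_rid)
qed

text \<open>Gram--Schmidt for the inner product \<open>v, w \<mapsto> v \<bullet> (C *v w)\<close>.\<close>
lemma pos_def_mat_orthonormal_family:
  fixes C :: "real^'p^'p"
  assumes C: "pos_def_mat C" and "finite I" "card I \<le> CARD('p)"
  shows "\<exists>f :: 'i \<Rightarrow> real^'p. \<forall>i\<in>I. \<forall>j\<in>I. f i \<bullet> (C *v f j) = (if i = j then 1 else 0)"
  using assms(2,3)
proof (induction I rule: finite_induct)
  case (insert k I)
  then obtain f :: "'i \<Rightarrow> real^'p"
    where f: "\<And>i j. i \<in> I \<Longrightarrow> j \<in> I \<Longrightarrow> f i \<bullet> (C *v f j) = (if i = j then 1 else 0)"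
    by auto
  have sym: "v \<bullet> (C *v w) = w \<bullet> (C *v v)" for v w
    using C by (intro inner_matrix_vector_mult_commute) (simp add: pos_def_mat_def)
  \<comment> \<open>Orthogonality to the family with respect to \<open>C\<close> is ordinary
    orthogonality to the vectors \<open>C *v f i\<close>. These are fewer than the dimension, so a
    nonzero \<open>v\<close> exists.\<close>
  have "dim ((\<lambda>i. C *v f i) ` I) \<le> card I"
    using insert.hyps(1) by (metis card_image_le dim_le_card' finite_imageI order_trans)
  also have "\<dots> < DIM(real^'p)"
    using insert by simp
  finally obtain v where v: "v \<noteq> 0" "\<And>y. y \<in> span ((\<lambda>i. C *v f i) ` I) \<Longrightarrow> orthogonal v y"
    using orthogonal_to_subspace_exists by blast
  have orth: "v \<bullet> (C *v f i) = 0" if "i \<in> I" for i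
    using v(2)[OF span_base] that by (simp add: orthogonal_def)
  define s where "s = v \<bullet> (C *v v)"
  have s: "s > 0"
    using C v(1) by (simp add: s_def pos_def_mat_def)
  define u where "u = (1 / sqrt s) *\<^sub>R v"
  have uu: "u \<bullet> (C *v u) = 1"
    using s by (simp add: u_def matrix_vector_mult_scaleR flip: s_def)
  have uf: "u \<bullet> (C *v f i) = 0" "f i \<bullet> (C *v u) = 0" if "i \<in> I" for i
    using orth[OF that] sym[of "f i" u] by (simp_all add: u_def)
  have "\<forall>i\<in>insert k I. \<forall>j\<in>insert k I. (f(k := u)) i \<bullet> (C *v (f(k := u)) j) = (if i = j then 1 else 0)"
    using f uu uf insert.hyps(2) by auto
  then show ?case
    by blast
qed simp

text \<open>If the columns of \<open>B\<close> are orthonormal for \<open>C\<close>, then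
  \<open>transpose B ** C ** B = mat 1\<close>, and for square matrices this rearranges to
  \<open>C ** (B ** transpose B) = mat 1\<close>. Thus \<open>B\<close> is a square-root factor of
  the inverse, from which a Gaussian vector can be built.\<close>

lemma pos_def_mat_inv_factorization:
  fixes C :: "real^'p^'p"
  assumes C: "pos_def_mat C"
  obtains f :: "'p \<Rightarrow> real^'p" where "\<And>t. t \<bullet> (matrix_inv C *v t) = (\<Sum>j\<in>UNIV. (t \<bullet> f j)\<^sup>2)"
proof -
  obtain f :: "'p \<Rightarrow> real^'p" where f: "\<And>i j. f i \<bullet> (C *v f j) = (if i = j then 1 else 0)"
    using pos_def_mat_orthonormal_family[OF C, of "UNIV :: 'p set"] by auto
  define B where "B = (\<chi> i j. f j $ i)"
  have col: "C ** B = (\<chi> i j. (C *v f j) $ i)"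
    by (simp add: B_def matrix_matrix_mult_def matrix_vector_mult_def)
  have "transpose B ** (C ** B) = mat 1"
    unfolding col using f
    by (simp add: B_def matrix_matrix_mult_def transpose_def mat_def vec_eq_iff inner_vec_def)
  then have "(C ** B) ** transpose B = mat 1"
    by (rule matrix_left_right_inverse[THEN iffD1])
  then have "C ** (B ** transpose B) = mat 1"
    by (simp add: matrix_mul_assoc)
  then have inv: "matrix_inv C = B ** transpose B"
    by (metis C matrix_inv_left matrix_mul_assoc matrix_mul_lid matrix_mul_rid pos_def_mat_invertible)
  have "t \<bullet> (matrix_inv C *v t) = (\<Sum>j\<in>UNIV. (t \<bullet> f j)\<^sup>2)" for t
  proof -
    have "t \<bullet> (matrix_inv C *v t) = (transpose B *v t) \<bullet> (transpose B *v t)"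
      unfolding inv
      by (metis dot_lmul_matrix matrix_vector_mul_assoc transpose_matrix_vector)
    also have "\<dots> = (\<Sum>j\<in>UNIV. (t \<bullet> f j)\<^sup>2)"
      by (simp add: inner_vec_def B_def transpose_def matrix_vector_mult_def power2_eq_square mult.commute)
    finally show ?thesis .
  qed
  then show thesis
    using that by blast
qed

subsection \<open>Gaussian vectors\<close>

lemma measurable_PiM_to_vec:
  fixes f :: "'i \<Rightarrow> real^'p"
  assumes "\<And>i. i \<in> I \<Longrightarrow> sets (M i) = sets borel"
  shows "(\<lambda>g. \<Sum>i\<in>I. g i *\<^sub>R f i) \<in> borel_measurable (PiM I M)"
proof (intro borel_measurable_sum borel_measurable_scaleR)
  fix i assume "i \<in> I"
  then show "(\<lambda>g. g i) \<in> borel_measurable (PiM I M)"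
    using measurable_component_singleton[of i I M] assms[of i]
    by (metis measurable_cong_sets)
qed simp

text \<open>The witness is the law of the combination of the vectors \<open>f j\<close> with
  independent standard normal coefficients. Its characteristic function factors over
  \<open>j\<close>, and the exponents add up to the quadratic form of \<open>S\<close>.\<close>

lemma mvnormal0_exists:
  fixes S :: "real^'p^'p" and f :: "'i::finite \<Rightarrow> real^'p"
  assumes S: "\<And>t. t \<bullet> (S *v t) = (\<Sum>j\<in>UNIV. (t \<bullet> f j)\<^sup>2)"
  obtains N where "mvnormal0 N S"
proof -
  let ?M = "\<lambda>_::'i. std_normal_distribution"
  let ?P = "PiM (UNIV :: 'i set) ?M"
  let ?X = "\<lambda>g. \<Sum>j\<in>UNIV. g j *\<^sub>R f j"
  interpret G: prob_space std_normal_distribution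
    by (simp add: prob_space_normal_density)
  interpret product_prob_space ?M UNIV ..
  have X: "?X \<in> borel_measurable ?P"
    by (rule measurable_PiM_to_vec) simp
  define N where "N = distr ?P borel ?X"
  have char: "(CLINT z|N. cis (t \<bullet> z)) = complex_of_real (exp (- (t \<bullet> (S *v t)) / 2))" for t
  proof -
    have cis_meas: "(\<lambda>z. cis (t \<bullet> z)) \<in> borel_measurable borel"
      unfolding cis_conv_exp by simp
    have "(CLINT z|N. cis (t \<bullet> z)) = (CLINT g|?P. cis (t \<bullet> ?X g))"
      unfolding N_def using X cis_meas by (rule integral_distr)
    also have "\<dots> = (CLINT g|?P. (\<Prod>j\<in>UNIV. cis ((t \<bullet> f j) * g j)))"
      by (simp add: cis_conv_exp inner_sum_right exp_sum[symmetric] sum_distrib_left mult_ac)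
    also have "\<dots> = (\<Prod>j\<in>UNIV. CLINT y|std_normal_distribution. cis ((t \<bullet> f j) * y))"
    proof (rule product_integral_prod)
      show "integrable std_normal_distribution (\<lambda>y. cis ((t \<bullet> f j) * y))" for j
        by (rule G.integrable_const_bound[where B = 1]) (simp_all add: cis_conv_exp)
    qed simp
    also have "\<dots> = (\<Prod>j\<in>UNIV. char std_normal_distribution (t \<bullet> f j))"
      by (simp add: char_def cis_conv_exp)
    also have "\<dots> = complex_of_real (exp (\<Sum>j\<in>UNIV. - ((t \<bullet> f j)\<^sup>2) / 2))"
      by (simp add: char_std_normal_distribution exp_sum)
    also have "(\<Sum>j\<in>UNIV. - ((t \<bullet> f j)\<^sup>2) / 2) = - (t \<bullet> (S *v t)) / 2"
      by (simp add: S sum_negf sum_divide_distrib)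
    finally show ?thesis .
  qed
  have "prob_space N"
    unfolding N_def using X by (rule prob_space_distr)
  then have "mvnormal0 N S"
    using char by (simp add: mvnormal0_def N_def)
  then show thesis
    by (rule that)
qed

subsection \<open>The criterion near its minimum\<close>

lemma gram_mult_vec: "gram x n *v w = (\<Sum>k<n. (x k \<bullet> w) *\<^sub>R x k)"
proof -
  have "(\<Sum>j\<in>UNIV. (\<Sum>k<n. x k $ i * x k $ j) * w $ j) = (\<Sum>k<n. (\<Sum>j\<in>UNIV. x k $ j * w $ j) * x k $ i)" for i
    by (simp add: sum_distrib_left sum_distrib_right mult_ac) (rule sum.swap)
  then show ?thesis
    by (simp add: vec_eq_iff gram_def matrix_vector_mult_def inner_vec_def)
qed

lemma inner_gram: "v \<bullet> (gram x n *v w) = (\<Sum>k<n. (x k \<bullet> v) * (x k \<bullet> w))"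
  by (simp add: gram_mult_vec inner_sum_right mult.commute inner_commute)

text \<open>The conjugate factor \<open>sqrt a + sqrt b\<close> is at least 2 because both roots are
  at least 1.\<close>

lemma abs_sqrt_diff_le:
  fixes a b :: real
  assumes "a \<ge> 1" "b \<ge> 1"
  shows "\<bar>sqrt a - sqrt b\<bar> \<le> \<bar>a - b\<bar> / 2"
proof -
  have "a - b = (sqrt a - sqrt b) * (sqrt a + sqrt b)"
    using assms by (simp add: algebra_simps)
  then have "\<bar>a - b\<bar> = \<bar>sqrt a - sqrt b\<bar> * (sqrt a + sqrt b)"
    using assms by (simp add: abs_mult)
  moreover have "\<bar>sqrt a - sqrt b\<bar> * 2 \<le> \<bar>sqrt a - sqrt b\<bar> * (sqrt a + sqrt b)"
    using add_mono[OF real_sqrt_ge_one[OF assms(1)] real_sqrt_ge_one[OF assms(2)]]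
    by (intro mult_left_mono) simp_all
  ultimately show ?thesis
    by simp
qed

definition sqrt_penalty :: "real \<Rightarrow> real \<Rightarrow> real^'p \<Rightarrow> real" where
  "sqrt_penalty eta alpha b = eta / alpha * (\<Sum>j\<in>UNIV. sqrt (1 + 2 * alpha * \<bar>b $ j\<bar>) - 1)"

text \<open>The Lipschitz bound for the root yields a factor \<open>alpha\<close>, which cancels the
  \<open>1 / alpha\<close> in front of the sum. \<open>CARD('p)\<close> arises by bounding each
  coordinate difference by the full norm.\<close>

lemma sqrt_penalty_diff_le:
  fixes b c :: "real^'p"
  assumes "eta > 0" "alpha > 0"
  shows "sqrt_penalty eta alpha c - sqrt_penalty eta alpha b \<le> real CARD('p) * eta * norm (b - c)"
proof -
  have "sqrt (1 + 2 * alpha * \<bar>c $ j\<bar>) - sqrt (1 + 2 * alpha * \<bar>b $ j\<bar>) \<le> alpha * norm (b - c)" for j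
  proof -
    have "sqrt (1 + 2 * alpha * \<bar>c $ j\<bar>) - sqrt (1 + 2 * alpha * \<bar>b $ j\<bar>) \<le>
        \<bar>(1 + 2 * alpha * \<bar>c $ j\<bar>) - (1 + 2 * alpha * \<bar>b $ j\<bar>)\<bar> / 2"
      by (rule order_trans[OF abs_ge_self abs_sqrt_diff_le]) (use assms in simp_all)
    also have "\<dots> = alpha * \<bar>\<bar>c $ j\<bar> - \<bar>b $ j\<bar>\<bar>"
    proof -
      have "(1 + 2 * alpha * \<bar>c $ j\<bar>) - (1 + 2 * alpha * \<bar>b $ j\<bar>) = 2 * alpha * (\<bar>c $ j\<bar> - \<bar>b $ j\<bar>)"
        by (simp add: algebra_simps)
      then show ?thesis
        using assms by (simp add: abs_mult)
    qed
    also have "\<dots> \<le> alpha * norm (b - c)"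
    proof (rule mult_left_mono)
      have "\<bar>\<bar>c $ j\<bar> - \<bar>b $ j\<bar>\<bar> \<le> \<bar>(b - c) $ j\<bar>"
        by simp
      also have "\<dots> \<le> norm (b - c)"
        by (rule component_le_norm_cart)
      finally show "\<bar>\<bar>c $ j\<bar> - \<bar>b $ j\<bar>\<bar> \<le> norm (b - c)" .
    qed (use assms in simp)
    finally show ?thesis .
  qed
  then have "(\<Sum>j\<in>UNIV. sqrt (1 + 2 * alpha * \<bar>c $ j\<bar>) - sqrt (1 + 2 * alpha * \<bar>b $ j\<bar>)) \<le>
      real CARD('p) * (alpha * norm (b - c))"
    by (rule sum_bounded_above)
  then have "eta / alpha * (\<Sum>j\<in>UNIV. sqrt (1 + 2 * alpha * \<bar>c $ j\<bar>) - sqrt (1 + 2 * alpha * \<bar>b $ j\<bar>)) \<le>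
      eta / alpha * (real CARD('p) * (alpha * norm (b - c)))"
    using assms by (intro mult_left_mono) auto
  then show ?thesis
    using assms by (simp add: sqrt_penalty_def sum_subtractf field_simps)
qed

lemma sqrt_pen_obj_shift:
  fixes b :: "real^'p"
  shows "sqrt_pen_obj x (\<lambda>k. x k \<bullet> b + e k) n eta alpha (b + v) =
    (\<Sum>k<n. (e k)\<^sup>2) - 2 * (v \<bullet> (\<Sum>k<n. e k *\<^sub>R x k)) + v \<bullet> (gram x n *v v) + sqrt_penalty eta alpha (b + v)"
proof -
  have "(x k \<bullet> b + e k - x k \<bullet> (b + v))\<^sup>2 = (e k)\<^sup>2 - 2 * (e k * (v \<bullet> x k)) + (x k \<bullet> v) * (x k \<bullet> v)" for k
    by (simp add: inner_add_right power2_eq_square algebra_simps inner_commute)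
  then show ?thesis
    by (simp add: sqrt_pen_obj_def sqrt_penalty_def inner_gram inner_sum_right sum.distrib
        sum_subtractf sum_distrib_left)
qed

text \<open>Compares the minimizer with the point \<open>b + w\<close> where the unpenalized quadratic would be minimal
  if the normalized Gram matrix were already \<open>C\<close>.\<close>
lemma sqrt_pen_minimizer_close:
  fixes b b' :: "real^'p" and C :: "real^'p^'p"
  assumes "eta > 0" "alpha > 0" "n > 0" "c > 0"
    and coercive: "\<And>v. c * (norm v)\<^sup>2 \<le> v \<bullet> (((1 / real n) *\<^sub>R gram x n) *v v)"
    and w: "C *v w = (1 / real n) *\<^sub>R (\<Sum>k<n. e k *\<^sub>R x k)"
    and le: "sqrt_pen_obj x (\<lambda>k. x k \<bullet> b + e k) n eta alpha b' \<le>
      sqrt_pen_obj x (\<lambda>k. x k \<bullet> b + e k) n eta alpha (b + w)"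
  shows "c * norm (b' - b - w) \<le>
    2 * (norm (C - (1 / real n) *\<^sub>R gram x n) * norm w) + real CARD('p) * eta / real n"
proof -
  define G where "G = (1 / real n) *\<^sub>R gram x n"
  define S where "S = (\<Sum>k<n. e k *\<^sub>R x k)"
  define v where "v = b' - b"
  define D where "D = v - w"
  have gram: "gram x n *v u = real n *\<^sub>R (G *v u)" for u
    using assms(3) by (simp add: G_def scaleR_matrix_vector_assoc[symmetric])
  have S: "S = real n *\<^sub>R (C *v w)"
    using assms(3) by (simp add: w S_def)
  have sym: "p \<bullet> (gram x n *v q) = q \<bullet> (gram x n *v p)" for p q
    by (simp add: inner_gram mult.commute)
  have "b' = b + v" "b' - (b + w) = D"
    by (simp_all add: v_def D_def)
  \<comment> \<open>In the comparison of the two criteria the sums of squared errors cancel, and the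
    penalty difference is bounded by its Lipschitz constant.\<close>
  then have "v \<bullet> (gram x n *v v) - 2 * (v \<bullet> S) - (w \<bullet> (gram x n *v w) - 2 * (w \<bullet> S)) \<le>
      real CARD('p) * eta * norm D"
    using le sqrt_penalty_diff_le[OF assms(1,2), of "b + w" b']
    by (simp add: sqrt_pen_obj_shift S_def)
  moreover have "v \<bullet> (gram x n *v v) = w \<bullet> (gram x n *v w) + 2 * (D \<bullet> (gram x n *v w)) + D \<bullet> (gram x n *v D)"
  proof -
    have "v = w + D"
      by (simp add: D_def)
    then show ?thesis
      using sym[of w D] by (simp add: matrix_vector_right_distrib inner_add_left inner_add_right)
  qed
  moreover have "v \<bullet> S = w \<bullet> S + D \<bullet> S"
    by (simp add: D_def inner_diff_left)
  ultimately have "D \<bullet> (gram x n *v D) \<le> 2 * (D \<bullet> (S - gram x n *v w)) + real CARD('p) * eta * norm D"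
    by (simp add: inner_diff_right)
  \<comment> \<open>Since \<open>S = real n *\<^sub>R (C *v w)\<close>, the linear term left over at
    \<open>w\<close> is \<open>real n\<close> times \<open>(C - G) *v w\<close>: it vanishes to the
    extent that \<open>G\<close> agrees with \<open>C\<close>.\<close>
  then have "real n * (D \<bullet> (G *v D)) \<le> real n * (2 * (D \<bullet> ((C - G) *v w))) + real CARD('p) * eta * norm D"
    unfolding gram S by (simp add: matrix_vector_mult_diff_rdistrib inner_diff_right algebra_simps)
  then have "D \<bullet> (G *v D) \<le> 2 * (D \<bullet> ((C - G) *v w)) + real CARD('p) * eta * norm D / real n"
    using assms(3) by (simp add: field_simps)
  moreover have "D \<bullet> ((C - G) *v w) \<le> norm D * (norm (C - G) * norm w)"
    using norm_cauchy_schwarz[of D "(C - G) *v w"] norm_matrix_vector_mult_le[of "C - G" w]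
    by (meson mult_left_mono norm_ge_zero order_trans)
  moreover have "c * (norm D)\<^sup>2 \<le> D \<bullet> (G *v D)"
    unfolding G_def by (rule coercive)
  ultimately have "norm D * (c * norm D) \<le>
      norm D * (2 * (norm (C - G) * norm w) + real CARD('p) * eta / real n)"
    by (simp add: power2_eq_square algebra_simps)
  \<comment> \<open>One factor \<open>norm D\<close> is cancelled; if \<open>D = 0\<close>, the
    right-hand side is nonnegative anyway.\<close>
  then have "c * norm D \<le> 2 * (norm (C - G) * norm w) + real CARD('p) * eta / real n"
    using assms by (cases "D = 0") auto
  then show ?thesis
    by (simp add: D_def v_def G_def)
qed

subsection \<open>Weighted sums of independent variables\<close>

text \<open>The newest summand is independent of the preceding partial sum and centered, so the
  cross term in the expanded square has expectation zero.\<close>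

lemma (in prob_space) square_sum_indep:
  fixes Y :: "nat \<Rightarrow> 'a \<Rightarrow> real"
  assumes indep: "indep_vars (\<lambda>_. borel) Y UNIV"
    and int: "\<And>i. integrable M (Y i)" and mean: "\<And>i. expectation (Y i) = 0"
    and sq: "\<And>i. integrable M (\<lambda>\<omega>. (Y i \<omega>)\<^sup>2)"
  shows integrable_square_sum_indep: "integrable M (\<lambda>\<omega>. (\<Sum>i<n. Y i \<omega>)\<^sup>2)" (is "?I n")
    and expectation_square_sum_indep:
      "expectation (\<lambda>\<omega>. (\<Sum>i<n. Y i \<omega>)\<^sup>2) = (\<Sum>i<n. expectation (\<lambda>\<omega>. (Y i \<omega>)\<^sup>2))" (is "?E n")
proof -
  have "?I n \<and> ?E n"
  proof (induction n)
    case (Suc n)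
    have "indep_var borel (Y n) borel (\<lambda>\<omega>. \<Sum>i<n. Y i \<omega>)"
      by (rule indep_vars_sum[OF _ _ indep_vars_subset[OF indep subset_UNIV]]) auto
    then have prod: "integrable M (\<lambda>\<omega>. Y n \<omega> * (\<Sum>i<n. Y i \<omega>))"
      "expectation (\<lambda>\<omega>. Y n \<omega> * (\<Sum>i<n. Y i \<omega>)) = 0"
      using indep_var_integrable[of "Y n" "\<lambda>\<omega>. \<Sum>i<n. Y i \<omega>"]
        indep_var_lebesgue_integral[of "Y n" "\<lambda>\<omega>. \<Sum>i<n. Y i \<omega>"] int mean
      by (auto intro: integrable_sum)
    have expand: "(\<Sum>i<Suc n. Y i \<omega>)\<^sup>2 = (\<Sum>i<n. Y i \<omega>)\<^sup>2 + 2 * (Y n \<omega> * (\<Sum>i<n. Y i \<omega>)) + (Y n \<omega>)\<^sup>2" for \<omega>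
      by (simp add: power2_sum)
    show ?case
      unfolding expand using Suc prod sq by simp
  qed (simp add: prob_space)
  then show "?I n" "?E n"
    by blast+
qed

text \<open>Both functions are compared with \<open>1 - v * t\<^sup>2 / 2\<close>. With only two
  moments available, the error of the characteristic function is \<open>t\<^sup>2\<close> times a
  quantity that tends to 0 with \<open>t\<close>; the error of the exponential is of order
  \<open>t ^ 4\<close>.\<close>

lemma (in prob_space) char_near_gaussian:
  fixes X :: "'a \<Rightarrow> real"
  assumes X[measurable]: "X \<in> borel_measurable M"
    and int: "integrable M X" "integrable M (\<lambda>\<omega>. (X \<omega>)\<^sup>2)" and mean: "expectation X = 0"
    and var: "expectation (\<lambda>\<omega>. (X \<omega>)\<^sup>2) = v" and e: "e > 0"
  obtains d where "d > 0"
    "\<And>t. \<bar>t\<bar> \<le> d \<Longrightarrow> cmod (char (distr M borel X) t - exp (- v * t\<^sup>2 / 2)) \<le> e * t\<^sup>2"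
proof -
  \<comment> \<open>\<open>r\<close> is the Taylor remainder expectation, nondecreasing in
    \<open>d\<close>. The minimum with \<open>6 * (X \<omega>)\<^sup>2\<close> provides the
    dominating function, and the sequence \<open>d m\<close> replaces the continuous limit so that
    dominated convergence applies.\<close>
  define r where "r d = expectation (\<lambda>\<omega>. min (6 * (X \<omega>)\<^sup>2) (d * \<bar>X \<omega>\<bar> ^ 3))" for d
  define d where "d m = 1 / real (Suc m)" for m
  have d_lim: "d \<longlonglongrightarrow> 0"
    using LIMSEQ_inverse_real_of_nat unfolding d_def inverse_eq_divide .
  have v: "v \<ge> 0"
    unfolding var[symmetric] by simp
  have int_min: "integrable M (\<lambda>\<omega>. min (6 * (X \<omega>)\<^sup>2) (t * \<bar>X \<omega>\<bar> ^ 3))" if "t \<ge> 0" for t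
  proof (rule Bochner_Integration.integrable_bound)
    show "integrable M (\<lambda>\<omega>. 6 * (X \<omega>)\<^sup>2)"
      using int(2) by simp
  qed (use that in auto)
  have "(\<lambda>m. r (d m)) \<longlonglongrightarrow> expectation (\<lambda>_. 0)"
    unfolding r_def
  proof (rule integral_dominated_convergence[where w = "\<lambda>\<omega>. 6 * (X \<omega>)\<^sup>2"])
    show "AE \<omega> in M. (\<lambda>m. min (6 * (X \<omega>)\<^sup>2) (d m * \<bar>X \<omega>\<bar> ^ 3)) \<longlonglongrightarrow> 0"
    proof (rule AE_I2)
      fix \<omega>
      have "(\<lambda>m. min (6 * (X \<omega>)\<^sup>2) (d m * \<bar>X \<omega>\<bar> ^ 3)) \<longlonglongrightarrow> min (6 * (X \<omega>)\<^sup>2) (0 * \<bar>X \<omega>\<bar> ^ 3)"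
        by (intro tendsto_intros d_lim)
      then show "(\<lambda>m. min (6 * (X \<omega>)\<^sup>2) (d m * \<bar>X \<omega>\<bar> ^ 3)) \<longlonglongrightarrow> 0"
        by simp
    qed
    show "AE \<omega> in M. norm (min (6 * (X \<omega>)\<^sup>2) (d m * \<bar>X \<omega>\<bar> ^ 3)) \<le> 6 * (X \<omega>)\<^sup>2" for m
      by (rule AE_I2) (simp add: d_def)
  qed (use int in auto)
  then have "(\<lambda>m. r (d m) / 6 + v\<^sup>2 * (d m)\<^sup>2 / 4) \<longlonglongrightarrow> 0 / 6 + v\<^sup>2 * 0\<^sup>2 / 4"
    by (intro tendsto_intros d_lim) simp_all
  then have "eventually (\<lambda>m. r (d m) / 6 + v\<^sup>2 * (d m)\<^sup>2 / 4 < e) sequentially"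
    using e by (intro order_tendstoD(2)[of _ 0]) auto
  then obtain m where m: "r (d m) / 6 + v\<^sup>2 * (d m)\<^sup>2 / 4 < e"
    using eventually_sequentially by auto
  show thesis
  proof (rule that[of "d m"])
    show "d m > 0"
      by (simp add: d_def)
    fix t :: real
    assume t: "\<bar>t\<bar> \<le> d m"
    define h where "h = t\<^sup>2 * v / 2"
    have h: "h \<ge> 0"
      using v by (simp add: h_def)
    have "cmod (char (distr M borel X) t - (1 - h)) \<le> t\<^sup>2 / 6 * r \<bar>t\<bar>"
      using char_approx3'[OF X int mean _ refl, of v t] mean var by (simp add: h_def r_def)
    also have "\<dots> \<le> t\<^sup>2 / 6 * r (d m)"
      unfolding r_def using t int_min[of "\<bar>t\<bar>"] int_min[of "d m"]
      by (intro mult_left_mono integral_mono min.mono mult_right_mono) auto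
    finally have 1: "cmod (char (distr M borel X) t - (1 - h)) \<le> t\<^sup>2 / 6 * r (d m)" .
    \<comment> \<open>For \<open>h \<ge> 0\<close>,
      \<open>(1 + h) * (1 - h + h\<^sup>2) = 1 + h ^ 3 \<ge> 1\<close> gives the upper estimate; the
      lower one is \<open>exp (- h) \<ge> 1 - h\<close>.\<close>
    have "exp (- h) \<le> 1 / (1 + h)"
      using exp_ge_add_one_self[of h] h by (simp add: exp_minus field_simps)
    also have "\<dots> \<le> 1 - h + h\<^sup>2"
      using h by (simp add: field_simps power2_eq_square)
    finally have 2: "\<bar>(1 - h) - exp (- h)\<bar> \<le> h\<^sup>2"
      using exp_ge_add_one_self[of "- h"] by simp
    have "h\<^sup>2 = t\<^sup>2 * (v\<^sup>2 * t\<^sup>2 / 4)"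
      by (simp add: h_def power2_eq_square)
    also have "\<dots> \<le> t\<^sup>2 * (v\<^sup>2 * (d m)\<^sup>2 / 4)"
      using t by (intro mult_left_mono divide_right_mono) (auto simp: abs_le_square_iff[symmetric])
    finally have 3: "h\<^sup>2 \<le> t\<^sup>2 * (v\<^sup>2 * (d m)\<^sup>2 / 4)" .
    have "cmod (char (distr M borel X) t - exp (- h)) \<le>
        cmod (char (distr M borel X) t - (1 - h)) + cmod (complex_of_real (1 - h) - exp (- h))"
      using norm_triangle_ineq[of "char (distr M borel X) t - (1 - h)" "complex_of_real (1 - h) - exp (- h)"]
      by simp
    also have "cmod (complex_of_real (1 - h) - exp (- h)) = \<bar>(1 - h) - exp (- h)\<bar>"
      by (simp only: norm_of_real flip: of_real_diff)
    also have "cmod (char (distr M borel X) t - (1 - h)) + \<bar>(1 - h) - exp (- h)\<bar> \<le>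
        t\<^sup>2 / 6 * r (d m) + t\<^sup>2 * (v\<^sup>2 * (d m)\<^sup>2 / 4)"
      using 1 2 3 by linarith
    also have "\<dots> = t\<^sup>2 * (r (d m) / 6 + v\<^sup>2 * (d m)\<^sup>2 / 4)"
      by (simp add: algebra_simps)
    also have "\<dots> \<le> t\<^sup>2 * e"
      using m by (intro mult_left_mono) auto
    finally show "cmod (char (distr M borel X) t - exp (- v * t\<^sup>2 / 2)) \<le> e * t\<^sup>2"
      by (simp add: h_def mult.commute)
  qed
qed

text \<open>A central limit theorem for triangular weights. By independence the characteristic
  function is a product; it is compared with the product of the factors
  \<open>exp (- v * (a n k)\<^sup>2 / 2)\<close>. All factors have modulus at most 1, so the
  products differ by at most the sum of the factorwise errors, which are small multiples of
  \<open>(a n k)\<^sup>2\<close> once the weights are uniformly small.\<close>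

lemma (in prob_space) weighted_sum_char_tendsto:
  fixes X :: "nat \<Rightarrow> 'a \<Rightarrow> real" and a :: "nat \<Rightarrow> nat \<Rightarrow> real"
  assumes X[measurable]: "\<And>i. X i \<in> borel_measurable M"
    and indep: "indep_vars (\<lambda>_. borel) X UNIV"
    and ident: "\<And>i. distr M borel (X i) = distr M borel (X 0)"
    and int: "integrable M (X 0)" "integrable M (\<lambda>\<omega>. (X 0 \<omega>)\<^sup>2)" and mean: "expectation (X 0) = 0"
    and var: "expectation (\<lambda>\<omega>. (X 0 \<omega>)\<^sup>2) = v"
    and lim: "(\<lambda>n. \<Sum>k<n. (a n k)\<^sup>2) \<longlonglongrightarrow> s"
    and negligible: "\<And>d. d > 0 \<Longrightarrow> eventually (\<lambda>n. \<forall>k<n. \<bar>a n k\<bar> \<le> d) sequentially"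
  shows "(\<lambda>n. CLINT \<omega>|M. cis (\<Sum>k<n. a n k * X k \<omega>)) \<longlonglongrightarrow> complex_of_real (exp (- v * s / 2))"
proof -
  define \<phi> where "\<phi> = char (distr M borel (X 0))"
  have v: "v \<ge> 0"
    unfolding var[symmetric] by simp
  have prod: "(CLINT \<omega>|M. cis (\<Sum>k<n. a n k * X k \<omega>)) = (\<Prod>k<n. \<phi> (a n k))" for n
  proof -
    have "(CLINT \<omega>|M. cis (\<Sum>k<n. a n k * X k \<omega>)) = char (distr M borel (\<lambda>\<omega>. \<Sum>k<n. a n k * X k \<omega>)) 1"
      by (simp add: char_def integral_distr cis_conv_exp)
    also have "\<dots> = (\<Prod>k<n. char (distr M borel (\<lambda>\<omega>. a n k * X k \<omega>)) 1)"
      by (intro char_distr_sum indep_vars_compose2[OF indep_vars_subset[OF indep subset_UNIV]]) simp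
    also have "\<dots> = (\<Prod>k<n. \<phi> (a n k))"
    proof (rule prod.cong[OF refl])
      fix k
      have "char (distr M borel (\<lambda>\<omega>. a n k * X k \<omega>)) 1 = char (distr M borel (X k)) (a n k)"
        by (simp add: char_def integral_distr)
      then show "char (distr M borel (\<lambda>\<omega>. a n k * X k \<omega>)) 1 = \<phi> (a n k)"
        unfolding \<phi>_def using ident[of k] by simp
    qed
    finally show ?thesis .
  qed
  interpret D: real_distribution "distr M borel (X 0)"
    by (rule real_distribution_distr) simp
  have diff: "(\<lambda>n. (\<Prod>k<n. \<phi> (a n k)) - complex_of_real (exp (- v * (\<Sum>k<n. (a n k)\<^sup>2) / 2))) \<longlonglongrightarrow> 0"
  proof (rule LIMSEQ_I)
    fix e :: real
    assume e: "e > 0"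
    have s: "s \<ge> 0"
      using LIMSEQ_le_const[OF lim, of 0] by (simp add: sum_nonneg)
    \<comment> \<open>The sum of squared weights is eventually below \<open>s + 1\<close>; dividing
      by the larger \<open>s + 2\<close> makes the total error strictly less than
      \<open>e\<close>.\<close>
    define e' where "e' = e / (s + 2)"
    have e': "e' > 0" "e' * (s + 1) < e"
      using e s by (simp_all add: e'_def field_simps)
    obtain d where d: "d > 0" "\<And>t. \<bar>t\<bar> \<le> d \<Longrightarrow> cmod (\<phi> t - exp (- v * t\<^sup>2 / 2)) \<le> e' * t\<^sup>2"
      using char_near_gaussian[OF X int mean var e'(1)] unfolding \<phi>_def by blast
    have "eventually (\<lambda>n. (\<Sum>k<n. (a n k)\<^sup>2) < s + 1) sequentially"
      by (rule order_tendstoD(2)[OF lim]) simp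
    then have "eventually (\<lambda>n. norm ((\<Prod>k<n. \<phi> (a n k)) - exp (- v * (\<Sum>k<n. (a n k)\<^sup>2) / 2) - 0) < e) sequentially"
      using negligible[OF d(1)]
    proof eventually_elim
      case (elim n)
      have "complex_of_real (exp (- v * (\<Sum>k<n. (a n k)\<^sup>2) / 2)) = (\<Prod>k<n. complex_of_real (exp (- v * (a n k)\<^sup>2 / 2)))"
        by (simp add: sum_distrib_left sum_divide_distrib exp_sum flip: of_real_prod sum_negf)
      then have "norm ((\<Prod>k<n. \<phi> (a n k)) - exp (- v * (\<Sum>k<n. (a n k)\<^sup>2) / 2)) \<le>
          (\<Sum>k<n. cmod (\<phi> (a n k) - exp (- v * (a n k)\<^sup>2 / 2)))"
        using v D.cmod_char_le_1 by (simp only:) (intro norm_prod_diff, auto simp: \<phi>_def)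
      also have "\<dots> \<le> (\<Sum>k<n. e' * (a n k)\<^sup>2)"
        using elim(2) by (intro sum_mono d(2)) auto
      also have "\<dots> = e' * (\<Sum>k<n. (a n k)\<^sup>2)"
        by (simp add: sum_distrib_left)
      also have "\<dots> \<le> e' * (s + 1)"
        using elim(1) e'(1) by (intro mult_left_mono) auto
      also note e'(2)
      finally show ?case
        by simp
    qed
    then show "\<exists>no. \<forall>n\<ge>no. norm ((\<Prod>k<n. \<phi> (a n k)) - exp (- v * (\<Sum>k<n. (a n k)\<^sup>2) / 2) - 0) < e"
      by (simp add: eventually_sequentially)
  qed
  have "(\<lambda>n. complex_of_real (exp (- v * (\<Sum>k<n. (a n k)\<^sup>2) / 2))) \<longlonglongrightarrow> complex_of_real (exp (- v * s / 2))"
    by (intro tendsto_intros lim) simp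
  from Lim_transform[OF this diff] show ?thesis
    unfolding prod .
qed

text \<open>The last term \<open>r n / real n\<close> is a difference of consecutive averages, up to
  the factor \<open>Suc n / n\<close>, and so tends to 0. For a uniform bound over
  \<open>k < n\<close>, late terms use \<open>r k \<le> e * real k \<le> e * real n\<close>, while
  the finitely many early terms are beaten by \<open>n\<close> itself.\<close>

lemma averages_convergent_imp_negligible:
  fixes r :: "nat \<Rightarrow> real"
  assumes r: "\<And>k. r k \<ge> 0" and lim: "(\<lambda>n. (\<Sum>k<n. r k) / real n) \<longlonglongrightarrow> s" and e: "e > 0"
  shows "eventually (\<lambda>n. \<forall>k<n. r k / real n \<le> e) sequentially"
proof -
  define q where "q n = (\<Sum>k<n. r k) / real n" for n
  have "(\<lambda>n. q (Suc n) * (real (Suc n) / real n) - q n) \<longlonglongrightarrow> s * 1 - s"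
    using lim unfolding q_def
    by (intro tendsto_intros LIMSEQ_Suc LIMSEQ_Suc_n_over_n)
  then have "eventually (\<lambda>n. q (Suc n) * (real (Suc n) / real n) - q n < e) sequentially"
    using e by (intro order_tendstoD(2)) auto
  then obtain N where N: "\<And>n. n \<ge> N \<Longrightarrow> q (Suc n) * (real (Suc n) / real n) - q n < e"
    by (auto simp: eventually_sequentially)
  \<comment> \<open>Starting at \<open>Suc N\<close> instead of \<open>N\<close> guarantees
    \<open>n > 0\<close>, so the quotient by \<open>real n\<close> is genuine.\<close>
  have large: "r n \<le> e * real n" if "n \<ge> Suc N" for n
  proof -
    have "q (Suc n) * (real (Suc n) / real n) = (\<Sum>k<Suc n. r k) / real n"
      by (simp only: q_def times_divide_times_eq mult.commute[of _ "real (Suc n)"]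
          mult_divide_mult_cancel_left)
    then have "q (Suc n) * (real (Suc n) / real n) - q n = r n / real n"
      by (simp add: q_def add_divide_distrib)
    then show ?thesis
      using N[of n] that by (simp add: field_simps)
  qed
  define R where "R = (\<Sum>k<Suc N. r k)"
  have small: "r k \<le> R" if "k < Suc N" for k
    unfolding R_def using that r by (intro member_le_sum) auto
  have "eventually (\<lambda>n. R / e \<le> real n) sequentially"
    using filterlim_real_sequentially unfolding filterlim_at_top by blast
  then show ?thesis
    using eventually_gt_at_top[of 0]
  proof eventually_elim
    case (elim n)
    have "r k \<le> e * real n" if "k < n" for k
    proof (cases "k < Suc N")
      case True
      then show ?thesis
        using small[of k] elim e by (simp add: field_simps)
    next
      case False
      then have "r k \<le> e * real k"
        using large[of k] by simp
      also have "\<dots> \<le> e * real n"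
        using that e by simp
      finally show ?thesis .
    qed
    then show ?case
      using elim(2) by (simp add: field_simps)
  qed
qed

subsection \<open>The penalized least squares estimator\<close>

lemma norm_cis_diff_le: "cmod (cis a - cis b) \<le> \<bar>a - b\<bar>"
proof -
  have "cis a - cis b = cis b * (cis (a - b) - 1)"
    by (simp add: right_diff_distrib cis_mult)
  then have "cmod (cis a - cis b) = cmod (cis (a - b) - 1)"
    by (simp add: norm_mult)
  also have "\<dots> \<le> \<bar>a - b\<bar>"
    using iexp_approx1[of "a - b" 0] by (simp add: cis_conv_exp)
  finally show ?thesis .
qed

text \<open>\<open>cis\<close> is 1-Lipschitz, so closeness in mean forces closeness of
  characteristic functions. This takes the place of Slutsky's theorem below.\<close>

lemma (in prob_space) char_diff_le:
  fixes X Y :: "'a \<Rightarrow> 'b::euclidean_space"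
  assumes "X \<in> borel_measurable M" "Y \<in> borel_measurable M" "integrable M (\<lambda>\<omega>. X \<omega> - Y \<omega>)"
  shows "cmod ((CLINT \<omega>|M. cis (t \<bullet> X \<omega>)) - (CLINT \<omega>|M. cis (t \<bullet> Y \<omega>))) \<le>
    norm t * expectation (\<lambda>\<omega>. norm (X \<omega> - Y \<omega>))"
proof -
  have int: "integrable M (\<lambda>\<omega>. cis (t \<bullet> X \<omega>))" "integrable M (\<lambda>\<omega>. cis (t \<bullet> Y \<omega>))"
    using assms by (auto intro: integrable_cis)
  have "cmod ((CLINT \<omega>|M. cis (t \<bullet> X \<omega>)) - (CLINT \<omega>|M. cis (t \<bullet> Y \<omega>))) =
      cmod (CLINT \<omega>|M. cis (t \<bullet> X \<omega>) - cis (t \<bullet> Y \<omega>))"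
    using int by simp
  also have "\<dots> \<le> expectation (\<lambda>\<omega>. cmod (cis (t \<bullet> X \<omega>) - cis (t \<bullet> Y \<omega>)))"
    by (rule Bochner_Integration.integral_norm_bound)
  also have "\<dots> \<le> expectation (\<lambda>\<omega>. norm t * norm (X \<omega> - Y \<omega>))"
  proof (rule integral_mono)
    fix \<omega>
    have "cmod (cis (t \<bullet> X \<omega>) - cis (t \<bullet> Y \<omega>)) \<le> \<bar>t \<bullet> (X \<omega> - Y \<omega>)\<bar>"
      using norm_cis_diff_le by (simp add: inner_diff_right)
    then show "cmod (cis (t \<bullet> X \<omega>) - cis (t \<bullet> Y \<omega>)) \<le> norm t * norm (X \<omega> - Y \<omega>)"
      using Cauchy_Schwarz_ineq2[of t "X \<omega> - Y \<omega>"] by linarith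
  qed (use int assms(3) in auto)
  finally show ?thesis
    by simp
qed

theorem theorem5:
  fixes M :: "'a measure"
    and x :: "nat \<Rightarrow> real^'p"
    and bstar :: "real^'p"
    and eps :: "nat \<Rightarrow> 'a \<Rightarrow> real"
    and sigma :: real
    and C :: "real^'p^'p"
    and eta alpha :: "nat \<Rightarrow> real"
    and btil :: "nat \<Rightarrow> 'a \<Rightarrow> real^'p"
  assumes M: "prob_space M"
    and eps_rv: "\<And>i. eps i \<in> borel_measurable M"
    and eps_indep: "prob_space.indep_vars M (\<lambda>_. borel) eps UNIV"
    and eps_ident: "\<And>i. distr M borel (eps i) = distr M borel (eps 0)"
    and eps_int: "integrable M (eps 0)"
    and eps_mean: "integral\<^sup>L M (eps 0) = 0"
    and eps_sq_int: "integrable M (\<lambda>\<omega>. (eps 0 \<omega>)^2)"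
    and eps_var: "integral\<^sup>L M (\<lambda>\<omega>. (eps 0 \<omega>)^2) = sigma^2"
    and gram_lim: "(\<lambda>n. (1 / real n) *\<^sub>R gram x n) \<longlonglongrightarrow> C"
    and C_pd: "pos_def_mat C"
    and eta_pos: "\<And>n. eta n > 0"
    and alpha_pos: "\<And>n. alpha n > 0"
    and alpha_lim: "alpha \<longlonglongrightarrow> 0"
    and btil_rv: "\<And>n. btil n \<in> borel_measurable M"
    and btil_min: "\<And>n \<omega> b. \<omega> \<in> space M \<Longrightarrow>
        sqrt_pen_obj x (\<lambda>k. x k \<bullet> bstar + eps k \<omega>) n (eta n) (alpha n) (btil n \<omega>)
        \<le> sqrt_pen_obj x (\<lambda>k. x k \<bullet> bstar + eps k \<omega>) n (eta n) (alpha n) b"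
  shows "(\<forall>c3\<ge>0. (\<lambda>n. eta n / sqrt (real n)) \<longlonglongrightarrow> 2 * c3 \<longrightarrow> conv_in_prob M btil bstar)
       \<and> ((\<lambda>n. eta n / sqrt (real n)) \<longlonglongrightarrow> 0 \<longrightarrow>
           (\<exists>N. mvnormal0 N (sigma^2 *\<^sub>R matrix_inv C) \<and>
                conv_in_dist M (\<lambda>n \<omega>. sqrt (real n) *\<^sub>R (btil n \<omega> - bstar)) N))"
proof -
  interpret prob_space M
    by (rule M)
  note [measurable] = eps_rv btil_rv
  define L where "L = matrix_inv C"
  define G where "G n = (1 / real n) *\<^sub>R gram x n" for n
  \<comment> \<open>\<open>U n\<close> is the linear statistic, \<open>u n\<close> the rescaled
    estimation error, and \<open>a t n k\<close> the weight of \<open>eps k\<close> in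
    \<open>t \<bullet> U n\<close>. For \<open>n = 0\<close> division by zero makes
    \<open>U 0\<close> vanish, so its moment bounds hold for every \<open>n\<close>.\<close>
  define U where "U n \<omega> = (1 / sqrt (real n)) *\<^sub>R (L *v (\<Sum>k<n. eps k \<omega> *\<^sub>R x k))" for n \<omega>
  define u where "u n \<omega> = sqrt (real n) *\<^sub>R (btil n \<omega> - bstar)" for n \<omega>
  define a where "a t n k = ((L *v t) \<bullet> x k) / sqrt (real n)" for t n k

  have inv: "invertible C" and symC: "transpose C = C"
    using C_pd by (auto intro: pos_def_mat_invertible simp: pos_def_mat_def)
  have CL: "C *v (L *v t) = t" for t
    unfolding L_def by (rule matrix_inv_vector_mult[OF inv])
  have symL: "transpose L = L"
    unfolding L_def by (rule transpose_matrix_inv_eq[OF inv symC])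
  have G_lim: "G \<longlonglongrightarrow> C"
    unfolding G_def by (rule gram_lim)

  \<comment> \<open>Limiting characteristic function of the linear statistic\<close>
  have U_inner: "t \<bullet> U n \<omega> = (\<Sum>k<n. a t n k * eps k \<omega>)" for t n \<omega>
  proof -
    have "t \<bullet> U n \<omega> = ((L *v t) \<bullet> (\<Sum>k<n. eps k \<omega> *\<^sub>R x k)) / sqrt (real n)"
      using inner_matrix_vector_mult_commute[OF symL, of t] by (simp add: U_def inner_commute)
    then show ?thesis
      by (simp add: a_def inner_sum_right sum_divide_distrib mult.commute)
  qed
  have a_sq: "(\<Sum>k<n. (a t n k)\<^sup>2) = (L *v t) \<bullet> (G n *v (L *v t))" for t n
    by (simp add: a_def G_def scaleR_matrix_vector_assoc[symmetric] inner_gram inner_commute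
        sum_divide_distrib power_divide power2_eq_square)
  \<comment> \<open>The sum of squared weights is the quadratic form of \<open>G n\<close> at
    \<open>L *v t\<close>; in the limit \<open>C\<close> cancels one factor
    \<open>L\<close>.\<close>
  have a_sq_lim: "(\<lambda>n. \<Sum>k<n. (a t n k)\<^sup>2) \<longlonglongrightarrow> t \<bullet> (L *v t)" for t
  proof -
    have "bounded_linear (\<lambda>A :: real^'p^'p. A *v (L *v t))"
      by (rule bounded_linear_intro[where K = "norm (L *v t)"])
        (simp_all add: matrix_vector_mult_add_rdistrib scaleR_matrix_vector_assoc norm_matrix_vector_mult_le)
    then have "(\<lambda>n. (L *v t) \<bullet> (G n *v (L *v t))) \<longlonglongrightarrow> (L *v t) \<bullet> (C *v (L *v t))"
      by (intro tendsto_intros bounded_linear.tendsto[OF _ G_lim])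
    then show ?thesis
      by (simp add: a_sq CL inner_commute)
  qed
  \<comment> \<open>Convergence of the sums of squared weights, read as averages of
    \<open>((L *v t) \<bullet> x k)\<^sup>2\<close>, already forces each single weight to be
    uniformly small.\<close>
  have a_negligible: "eventually (\<lambda>n. \<forall>k<n. \<bar>a t n k\<bar> \<le> d) sequentially" if d: "d > 0" for t d
  proof -
    have eq: "(a t n k)\<^sup>2 = ((L *v t) \<bullet> x k)\<^sup>2 / real n" for n k
      by (simp add: a_def power_divide)
    have "(\<lambda>n. (\<Sum>k<n. ((L *v t) \<bullet> x k)\<^sup>2) / real n) \<longlonglongrightarrow> t \<bullet> (L *v t)"
      using a_sq_lim[of t] by (simp add: eq sum_divide_distrib)
    then have "eventually (\<lambda>n. \<forall>k<n. ((L *v t) \<bullet> x k)\<^sup>2 / real n \<le> d\<^sup>2) sequentially"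
      using d by (intro averages_convergent_imp_negligible) auto
    then show ?thesis
      using d by (simp add: eq[symmetric] abs_le_square_iff[symmetric])
  qed

  have U_char: "(\<lambda>n. CLINT \<omega>|M. cis (t \<bullet> U n \<omega>)) \<longlonglongrightarrow>
      complex_of_real (exp (- sigma\<^sup>2 * (t \<bullet> (L *v t)) / 2))" for t
    unfolding U_inner
    by (intro weighted_sum_char_tendsto eps_indep eps_ident eps_int eps_sq_int eps_mean eps_var
        a_sq_lim a_negligible eps_rv)

  \<comment> \<open>Moments of the linear statistic\<close>
  have eps_moments: "integrable M (eps i)" "expectation (eps i) = 0"
    "integrable M (\<lambda>\<omega>. (eps i \<omega>)\<^sup>2)" "expectation (\<lambda>\<omega>. (eps i \<omega>)\<^sup>2) = sigma\<^sup>2" for i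
  proof -
    have transfer: "integrable M (\<lambda>\<omega>. g (eps i \<omega>)) = integrable M (\<lambda>\<omega>. g (eps 0 \<omega>))"
      "expectation (\<lambda>\<omega>. g (eps i \<omega>)) = expectation (\<lambda>\<omega>. g (eps 0 \<omega>))"
      if [measurable]: "g \<in> borel_measurable borel" for g :: "real \<Rightarrow> real"
      using integrable_distr_eq[of "eps i" M borel g] integrable_distr_eq[of "eps 0" M borel g]
        integral_distr[of "eps i" M borel g] integral_distr[of "eps 0" M borel g] eps_ident[of i]
      by simp_all
    show "integrable M (eps i)" "expectation (eps i) = 0"
      "integrable M (\<lambda>\<omega>. (eps i \<omega>)\<^sup>2)" "expectation (\<lambda>\<omega>. (eps i \<omega>)\<^sup>2) = sigma\<^sup>2"
      using transfer[of "\<lambda>y. y"] transfer[of "\<lambda>y. y\<^sup>2"] eps_int eps_mean eps_sq_int eps_var by simp_all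
  qed
  have U_sq: "integrable M (\<lambda>\<omega>. (t \<bullet> U n \<omega>)\<^sup>2)"
    "expectation (\<lambda>\<omega>. (t \<bullet> U n \<omega>)\<^sup>2) = sigma\<^sup>2 * (\<Sum>k<n. (a t n k)\<^sup>2)" for t n
  proof -
    have indep: "indep_vars (\<lambda>_. borel) (\<lambda>k \<omega>. a t n k * eps k \<omega>) UNIV"
      by (rule indep_vars_compose2[OF eps_indep]) simp
    show "integrable M (\<lambda>\<omega>. (t \<bullet> U n \<omega>)\<^sup>2)"
      "expectation (\<lambda>\<omega>. (t \<bullet> U n \<omega>)\<^sup>2) = sigma\<^sup>2 * (\<Sum>k<n. (a t n k)\<^sup>2)"
      unfolding U_inner
      using integrable_square_sum_indep[OF indep, of n] expectation_square_sum_indep[OF indep, of n]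
      by (simp_all add: eps_moments power_mult_distrib sum_distrib_left mult.commute)
  qed
  have U_int: "integrable M (U n)" for n
    unfolding U_def
    by (intro integrable_scaleR_right integrable_bounded_linear[OF matrix_vector_mul_bounded_linear]
        Bochner_Integration.integrable_sum integrable_scaleR_left eps_moments)
  have [measurable]: "U n \<in> borel_measurable M" "u n \<in> borel_measurable M" for n
    using U_int[of n] unfolding u_def[abs_def] by auto
  obtain K where K: "\<And>n. expectation (\<lambda>\<omega>. norm (U n \<omega>)) \<le> K"
  proof -
    \<comment> \<open>Coordinatewise \<open>\<bar>y\<bar> \<le> 1 + y\<^sup>2\<close> bounds the
      mean norm by second moments. These are computed exactly, and \<open>B\<close> converges, hence
      is bounded.\<close>
    define B where "B n = (\<Sum>i\<in>UNIV. 1 + sigma\<^sup>2 * (\<Sum>k<n. (a (axis i 1) n k)\<^sup>2))" for n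
    have "B \<longlonglongrightarrow> (\<Sum>i\<in>UNIV. 1 + sigma\<^sup>2 * (axis i 1 \<bullet> (L *v axis i 1)))"
      unfolding B_def by (intro tendsto_intros a_sq_lim)
    then have "Bseq B"
      by (intro convergent_imp_Bseq convergentI)
    then obtain K where "\<forall>n. norm (B n) \<le> K"
      by (rule BseqE)
    then have K: "B n \<le> K" for n
      by (auto dest: abs_le_D1)
    have "expectation (\<lambda>\<omega>. norm (U n \<omega>)) \<le> B n" for n
    proof -
      have "norm (U n \<omega>) \<le> (\<Sum>i\<in>UNIV. 1 + (axis i 1 \<bullet> U n \<omega>)\<^sup>2)" for \<omega>
      proof -
        have "\<bar>y\<bar> \<le> 1 + y\<^sup>2" for y :: real
        proof -
          have "0 \<le> (\<bar>y\<bar> - 1)\<^sup>2"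
            by (rule zero_le_power2)
          then have "2 * \<bar>y\<bar> \<le> 1 + y\<^sup>2"
            by (simp add: power2_diff)
          then show ?thesis
            using abs_ge_zero[of y] by linarith
        qed
        then show ?thesis
          by (intro order_trans[OF norm_le_l1_cart] sum_mono) (simp add: inner_axis')
      qed
      then have "expectation (\<lambda>\<omega>. norm (U n \<omega>)) \<le> expectation (\<lambda>\<omega>. \<Sum>i\<in>UNIV. 1 + (axis i 1 \<bullet> U n \<omega>)\<^sup>2)"
        using U_int U_sq by (intro integral_mono) auto
      also have "\<dots> = B n"
        using U_sq by (simp add: prob_space B_def)
      finally show ?thesis .
    qed
    from order_trans[OF this K] show thesis
      by (rule that)
  qed

  \<comment> \<open>Approximation of the rescaled error by the linear statistic\<close>
  obtain c where c: "c > 0" "\<And>v. c * (norm v)\<^sup>2 \<le> v \<bullet> (C *v v)"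
    using pos_def_mat_lower_bound[OF C_pd] by blast
  \<comment> \<open>The perturbation \<open>G n - C\<close> costs at most half of the coercivity
    constant of \<open>C\<close>.\<close>
  have G_coercive: "eventually (\<lambda>n. \<forall>v. c / 2 * (norm v)\<^sup>2 \<le> v \<bullet> (G n *v v)) sequentially"
  proof -
    have "eventually (\<lambda>n. norm (G n - C) < c / 2) sequentially"
      using tendstoD[OF G_lim, of "c / 2"] c(1) by (simp add: dist_norm)
    then show ?thesis
    proof eventually_elim
      case (elim n)
      have "c / 2 * (norm v)\<^sup>2 \<le> v \<bullet> (G n *v v)" for v
      proof -
        have "\<bar>v \<bullet> ((G n - C) *v v)\<bar> \<le> norm v * (norm (G n - C) * norm v)"
          by (rule order_trans[OF Cauchy_Schwarz_ineq2])
            (intro mult_left_mono norm_matrix_vector_mult_le norm_ge_zero)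
        also have "\<dots> \<le> norm v * (c / 2 * norm v)"
          using elim by (intro mult_left_mono mult_right_mono) auto
        finally have "\<bar>v \<bullet> (G n *v v) - v \<bullet> (C *v v)\<bar> \<le> c / 2 * (norm v)\<^sup>2"
          by (simp add: matrix_vector_mult_diff_rdistrib inner_diff_right power2_eq_square mult_ac)
        from abs_le_D2[OF this] c(2)[of v] show ?thesis
          by (simp add: algebra_simps)
      qed
      then show ?case
        by blast
    qed
  qed

  \<comment> \<open>The constants come from \<open>sqrt_pen_minimizer_close\<close> with coercivity
    \<open>c / 2\<close>: its inequality is multiplied by \<open>2 / c\<close> and by
    \<open>sqrt (real n)\<close>, which turns \<open>eta n / real n\<close> into
    \<open>eta n / sqrt (real n)\<close>.\<close>
  define \<delta> where "\<delta> n = 4 / c * norm (C - G n)" for n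
  define \<rho> where "\<rho> n = 2 / c * real CARD('p) * (eta n / sqrt (real n))" for n
  have \<delta>_lim: "\<delta> \<longlonglongrightarrow> 0"
  proof -
    have "\<delta> \<longlonglongrightarrow> 4 / c * norm (C - C)"
      unfolding \<delta>_def by (intro tendsto_intros G_lim)
    then show ?thesis
      by simp
  qed
  have close: "eventually (\<lambda>n. \<forall>\<omega>\<in>space M. norm (u n \<omega> - U n \<omega>) \<le> \<delta> n * norm (U n \<omega>) + \<rho> n) sequentially"
    using G_coercive eventually_gt_at_top[of 0]
  proof eventually_elim
    case (elim n)
    show ?case
    proof
      fix \<omega>
      assume \<omega>: "\<omega> \<in> space M"
      define w where "w = (1 / sqrt (real n)) *\<^sub>R U n \<omega>"
      have n: "sqrt (real n) > 0" "sqrt (real n) * sqrt (real n) = real n"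
        using elim(2) by simp_all
      have w: "C *v w = (1 / real n) *\<^sub>R (\<Sum>k<n. eps k \<omega> *\<^sub>R x k)"
        using n by (simp add: w_def U_def matrix_vector_mult_scaleR CL)
      have Uw: "U n \<omega> = sqrt (real n) *\<^sub>R w"
        using n by (simp add: w_def)
      have "c / 2 * norm (btil n \<omega> - bstar - w) \<le>
          2 * (norm (C - G n) * norm w) + real CARD('p) * eta n / real n"
        unfolding G_def
        by (rule sqrt_pen_minimizer_close[OF eta_pos alpha_pos elim(2) _ _ w btil_min[OF \<omega>]])
          (use elim(1) c(1) in \<open>simp_all add: G_def\<close>)
      then have "norm (btil n \<omega> - bstar - w) \<le>
          2 / c * (2 * (norm (C - G n) * norm w) + real CARD('p) * eta n / real n)"
        using c(1) by (simp add: field_simps)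
      then have "sqrt (real n) * norm (btil n \<omega> - bstar - w) \<le>
          sqrt (real n) * (2 / c * (2 * (norm (C - G n) * norm w) + real CARD('p) * eta n / real n))"
        using n by (intro mult_left_mono) auto
      also have "\<dots> = \<delta> n * norm (U n \<omega>) + \<rho> n"
      proof -
        have eq: "sqrt (real n) * (eta n / real n) = eta n / sqrt (real n)"
          "norm (U n \<omega>) = sqrt (real n) * norm w"
          using n by (simp_all add: field_simps Uw)
        show ?thesis
          unfolding \<delta>_def \<rho>_def eq(1)[symmetric] eq(2) by (simp add: distrib_left mult_ac)
      qed
      also have "sqrt (real n) * norm (btil n \<omega> - bstar - w) = norm (u n \<omega> - U n \<omega>)"
        unfolding u_def Uw by (simp flip: scaleR_diff_right)
      finally show "norm (u n \<omega> - U n \<omega>) \<le> \<delta> n * norm (U n \<omega>) + \<rho> n" .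
    qed
  qed
  \<comment> \<open>Integrability of the difference follows from domination by an affine function of
    \<open>norm (U n \<omega>)\<close>, so it is obtained only for the large \<open>n\<close> at
    which coercivity holds.\<close>
  have close_mean: "eventually (\<lambda>n. integrable M (\<lambda>\<omega>. u n \<omega> - U n \<omega>) \<and>
      expectation (\<lambda>\<omega>. norm (u n \<omega> - U n \<omega>)) \<le> \<delta> n * K + \<rho> n) sequentially"
    using close
  proof eventually_elim
    case (elim n)
    have int: "integrable M (\<lambda>\<omega>. \<delta> n * norm (U n \<omega>) + \<rho> n)"
      using U_int by auto
    have int': "integrable M (\<lambda>\<omega>. u n \<omega> - U n \<omega>)"
      by (rule Bochner_Integration.integrable_bound[OF int]) (use elim in \<open>auto intro!: AE_I2\<close>)
    have "expectation (\<lambda>\<omega>. norm (u n \<omega> - U n \<omega>)) \<le> expectation (\<lambda>\<omega>. \<delta> n * norm (U n \<omega>) + \<rho> n)"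
      using elim int int' by (intro integral_mono) auto
    also have "\<dots> = \<delta> n * expectation (\<lambda>\<omega>. norm (U n \<omega>)) + \<rho> n"
      using U_int by (simp add: prob_space)
    also have "\<dots> \<le> \<delta> n * K + \<rho> n"
      using K c(1) by (intro add_right_mono mult_left_mono) (auto simp: \<delta>_def)
    finally show ?case
      using int' by blast
  qed
  have u_mean: "eventually (\<lambda>n. integrable M (u n) \<and>
      expectation (\<lambda>\<omega>. norm (u n \<omega>)) \<le> K + (\<delta> n * K + \<rho> n)) sequentially"
    using close_mean
  proof eventually_elim
    case (elim n)
    have int: "integrable M (u n)"
      using Bochner_Integration.integrable_add[OF conjunct1[OF elim] U_int[of n]] by simp
    have "expectation (\<lambda>\<omega>. norm (u n \<omega>)) \<le> expectation (\<lambda>\<omega>. norm (U n \<omega>) + norm (u n \<omega> - U n \<omega>))"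
      using int U_int elim norm_triangle_sub by (intro integral_mono) auto
    also have "\<dots> = expectation (\<lambda>\<omega>. norm (U n \<omega>)) + expectation (\<lambda>\<omega>. norm (u n \<omega> - U n \<omega>))"
      using U_int elim by (intro Bochner_Integration.integral_add) auto
    finally show ?case
      using int K[of n] elim by auto
  qed

  \<comment> \<open>Consistency\<close>
  have \<rho>_lim: "\<rho> \<longlonglongrightarrow> 2 / c * real CARD('p) * l" if "(\<lambda>n. eta n / sqrt (real n)) \<longlonglongrightarrow> l" for l
    unfolding \<rho>_def by (intro tendsto_intros that)
  have consistent: "conv_in_prob M btil bstar" if l: "(\<lambda>n. eta n / sqrt (real n)) \<longlonglongrightarrow> l" for l
    unfolding conv_in_prob_def
  proof (intro allI impI)
    fix e :: real
    assume e: "e > 0"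
    \<comment> \<open>The bound on the mean norm of \<open>u n\<close> has a finite limit, and
      undoing the rescaling contributes the factor \<open>1 / sqrt (real n)\<close> in Markov's
      inequality.\<close>
    have "(\<lambda>n. 1 / sqrt (real n)) \<longlonglongrightarrow> 0"
      by (intro tendsto_divide_0[OF tendsto_const] filterlim_at_top_imp_at_infinity
          filterlim_compose[OF sqrt_at_top filterlim_real_sequentially])
    then have "(\<lambda>n. (K + (\<delta> n * K + \<rho> n)) / e * (1 / sqrt (real n))) \<longlonglongrightarrow>
        (K + (0 * K + 2 / c * real CARD('p) * l)) / e * 0"
      using e by (intro tendsto_intros \<delta>_lim \<rho>_lim l) auto
    then have lim: "(\<lambda>n. (K + (\<delta> n * K + \<rho> n)) / e * (1 / sqrt (real n))) \<longlonglongrightarrow> 0"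
      by simp
    show "(\<lambda>n. prob {\<omega> \<in> space M. dist (btil n \<omega>) bstar > e}) \<longlonglongrightarrow> 0"
    proof (rule tendsto_sandwich[OF _ _ tendsto_const lim])
      show "eventually (\<lambda>n. prob {\<omega> \<in> space M. dist (btil n \<omega>) bstar > e} \<le>
          (K + (\<delta> n * K + \<rho> n)) / e * (1 / sqrt (real n))) sequentially"
        using u_mean eventually_gt_at_top[of 0]
      proof eventually_elim
        case (elim n)
        have n: "sqrt (real n) > 0"
          using elim(2) by simp
        have "{\<omega> \<in> space M. dist (btil n \<omega>) bstar > e} = {\<omega> \<in> space M. norm (u n \<omega>) > sqrt (real n) * e}"
          using n by (auto simp: u_def dist_norm)
        then have "prob {\<omega> \<in> space M. dist (btil n \<omega>) bstar > e} \<le>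
            expectation (\<lambda>\<omega>. norm (u n \<omega>)) / (sqrt (real n) * e)"
          using markov_norm[of "u n" "sqrt (real n) * e"] elim(1) n e by simp
        also have "\<dots> \<le> (K + (\<delta> n * K + \<rho> n)) / (sqrt (real n) * e)"
          using elim(1) n e by (intro divide_right_mono) auto
        finally show ?case
          by (simp add: mult.commute)
      qed
    qed simp
  qed

  \<comment> \<open>Asymptotic normality\<close>
  have normal: "\<exists>N. mvnormal0 N (sigma\<^sup>2 *\<^sub>R L) \<and> conv_in_dist M u N"
    if l: "(\<lambda>n. eta n / sqrt (real n)) \<longlonglongrightarrow> 0"
  proof -
    obtain f :: "'p \<Rightarrow> real^'p" where f: "\<And>t. t \<bullet> (L *v t) = (\<Sum>j\<in>UNIV. (t \<bullet> f j)\<^sup>2)"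
      using pos_def_mat_inv_factorization[OF C_pd] unfolding L_def by blast
    \<comment> \<open>Scaling the factor vectors by \<open>sigma\<close> produces the covariance;
      for \<open>sigma = 0\<close> the resulting law is the point mass at 0.\<close>
    have "t \<bullet> ((sigma\<^sup>2 *\<^sub>R L) *v t) = (\<Sum>j\<in>UNIV. (t \<bullet> (sigma *\<^sub>R f j))\<^sup>2)" for t
      by (simp add: scaleR_matrix_vector_assoc[symmetric] f sum_distrib_left power_mult_distrib)
    then obtain N where N: "mvnormal0 N (sigma\<^sup>2 *\<^sub>R L)"
      by (rule mvnormal0_exists)
    have N_char: "(CLINT z|N. cis (t \<bullet> z)) = complex_of_real (exp (- sigma\<^sup>2 * (t \<bullet> (L *v t)) / 2))" for t
      using N by (simp add: mvnormal0_def scaleR_matrix_vector_assoc[symmetric])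
    have err_lim: "(\<lambda>n. \<delta> n * K + \<rho> n) \<longlonglongrightarrow> 0"
      using tendsto_add[OF tendsto_mult_left_zero[OF \<delta>_lim] \<rho>_lim[OF l], of K] by simp
    have "conv_in_dist M u N"
    proof (rule conv_in_dist_if_char_tendsto[OF M])
      show "prob_space N" "sets N = sets borel"
        using N by (simp_all add: mvnormal0_def)
      show "(\<lambda>n. CLINT \<omega>|M. cis (t \<bullet> u n \<omega>)) \<longlonglongrightarrow> (CLINT z|N. cis (t \<bullet> z))" for t
      proof -
        \<comment> \<open>With the penalty term vanishing, \<open>u n\<close> and \<open>U n\<close>
          merge in mean, so they share the limiting characteristic function. The mean bound on
          \<open>u n\<close> then supplies tightness.\<close>
        have "(\<lambda>n. (CLINT \<omega>|M. cis (t \<bullet> u n \<omega>)) - (CLINT \<omega>|M. cis (t \<bullet> U n \<omega>))) \<longlonglongrightarrow> 0"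
        proof (rule Lim_null_comparison)
          show "eventually (\<lambda>n. cmod ((CLINT \<omega>|M. cis (t \<bullet> u n \<omega>)) - (CLINT \<omega>|M. cis (t \<bullet> U n \<omega>))) \<le>
              norm t * (\<delta> n * K + \<rho> n)) sequentially"
            using close_mean
          proof eventually_elim
            case (elim n)
            have "cmod ((CLINT \<omega>|M. cis (t \<bullet> u n \<omega>)) - (CLINT \<omega>|M. cis (t \<bullet> U n \<omega>))) \<le>
                norm t * expectation (\<lambda>\<omega>. norm (u n \<omega> - U n \<omega>))"
              using elim by (intro char_diff_le) auto
            also have "\<dots> \<le> norm t * (\<delta> n * K + \<rho> n)"
              using elim by (intro mult_left_mono) auto
            finally show ?case .
          qed
          show "(\<lambda>n. norm t * (\<delta> n * K + \<rho> n)) \<longlonglongrightarrow> 0"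
            by (rule tendsto_mult_right_zero[OF err_lim])
        qed
        from Lim_transform[OF U_char[of t] this] show ?thesis
          unfolding N_char .
      qed
      have "eventually (\<lambda>n. \<delta> n * K + \<rho> n < 1) sequentially"
        by (rule order_tendstoD(2)[OF err_lim]) simp
      then show "eventually (\<lambda>n. integrable M (u n) \<and> expectation (\<lambda>\<omega>. norm (u n \<omega>)) \<le> K + 1) sequentially"
        using u_mean by eventually_elim auto
    qed simp
    then show ?thesis
      using N by blast
  qed

  show ?thesis
    using consistent normal by (intro conjI allI impI) (simp_all only: u_def[abs_def] L_def)
qed

end
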